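(* (i) For every $f\in L^1(S)$, every $q\in[1,\infty]$ and every $\alpha\in\mathbb{R}$, $$\left(\int_N|\widetilde{f}(\alpha+i\gamma_q\rho,n)|^q\,dn\right)^{1/q}\le \|f\|_{1}$$ (for $q=\infty$ the left side is the $L^\infty(N)$ norm of $n\mapsto\widetilde f(\alpha+i\gamma_\infty\rho,n)$). (ii) Let $1<p<2$ and $p<q<p'$. There is a constant $C_{p,q}$ such that for every $f\in L^{p,\infty}(S)$ and every $\alpha\in\mathbb{R}$, $$\left(\int_N|\widetilde{f}(\alpha+i\gamma_q\rho,n)|^q\,dn\right)^{1/q}\le C_{p,q}\,\|f\|^\ast_{p,\infty}.$$
   Context: Let $\mathfrak n=\mathfrak v\oplus\mathfrak z$ be an $H$-type Lie algebra: a two-step nilpotent real Lie algebra with inner product, with centre $\mathfrak z$ and orthogonal complement $\mathfrak v$, $\dim\mathfrak v=m\ge1$, $\dim\mathfrak z=k\ge1$, such that for each $Z\in\mathfrak z$ the map $J_Z:\mathfrak v\to\mathfrak v$ given by $\langle J_ZX,X'\rangle=\langle Z,[X,X']\rangle$ satisfies $J_Z^2=-|Z|^2I$. Let $N=\exp\mathfrak n$ be the simply connected group, identified with $\mathbb R^m\times\mathbb R^k$ via $\exp$, with Lebesgue measure $dn$. Let $A=\{a_t=e^t:t\in\mathbb R\}$ act on $N$ by $a_t(X,Y)a_{-t}=(e^{t/2}X,e^{t}Y)$ and let $S=NA$ be the semidirect product (a Damek-Ricci space). Put $Q=m/2+k$, $\rho=Q/2$. The left Haar measure on $S$ is $\int_Sf(x)\,dx=\int_N\int_{\mathbb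 R}f(na_t)e^{-2\rho t}\,dt\,dn$. Poisson kernel: $P_{a_t}(V,Z)=C\,e^{tQ}\left(\left(e^t+|V|^2/4\right)^2+|Z|^2\right)^{-Q}$ for $(V,Z)\in N$, with $C$ chosen so that $\int_NP_{a_t}(n)\,dn=1$; $\mathcal P(n_1a_t,n)=P_{a_t}(n^{-1}n_1)$; and $\mathcal P_\lambda(x,n)=\mathcal P(x,n)^{1/2-i\lambda/Q}$ for $\lambda\in\mathbb C$. The Fourier transform of $f$ on $S$ is $\widetilde f(\lambda,n)=\int_Sf(x)\mathcal P_\lambda(x,n)\,dx$ whenever the integral converges. For $p\in[1,\infty)$: $p'=p/(p-1)$, $\gamma_p=2/p-1$; $\gamma_\infty=-1$. Lorentz (weak $L^p$) norm: $\|f\|^\ast_{p,\infty}=\sup_{t>0}t^{1/p}f^*(t)$, where $f^*$ is the nonincreasing rearrangement of $f$; $L^{p,\infty}(S)$ consists of the measurable $f$ with $\|f\|^\ast_{p,\infty}<\infty$. *)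

theory Defs
  imports "HOL-Analysis.Analysis" "HOL-Probability.Essential_Supremum"
begin

section \<open>H-type Lie algebras\<close>

text \<open>
  The Lie algebra is the orthogonal direct sum of \<open>'v\<close> and \<open>'z\<close>, realised as the Euclidean space
  \<open>'v \<times> 'z\<close>. The dimensions \<open>m = DIM('v)\<close> and \<open>k = DIM('z)\<close> are at least 1 by the type class.
\<close>

definition lie_bracket :: "('a::real_vector \<Rightarrow> 'a \<Rightarrow> 'a) \<Rightarrow> bool" where
  "lie_bracket br \<longleftrightarrow> bilinear br \<and> (\<forall>x. br x x = 0) \<and>
     (\<forall>x y w. br x (br y w) + br y (br w x) + br w (br x y) = 0)"

definition two_step_nilpotent :: "('a::real_vector \<Rightarrow> 'a \<Rightarrow> 'a) \<Rightarrow> bool" where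
  "two_step_nilpotent br \<longleftrightarrow> (\<forall>x y w. br (br x y) w = 0) \<and> (\<exists>x y. br x y \<noteq> 0)"

definition lie_centre :: "('a::real_vector \<Rightarrow> 'a \<Rightarrow> 'a) \<Rightarrow> 'a set" where
  "lie_centre br = {x. \<forall>y. br x y = 0}"

definition J_map ::
  "('v::euclidean_space \<times> 'z::euclidean_space \<Rightarrow> 'v \<times> 'z \<Rightarrow> 'v \<times> 'z) \<Rightarrow> 'z \<Rightarrow> 'v \<Rightarrow> 'v" where
  "J_map br Z X = (THE W. \<forall>X'. W \<bullet> X' = (0, Z) \<bullet> br (X, 0) (X', 0))"

lemma J_map_inner:
  fixes br :: "'v::euclidean_space \<times> 'z::euclidean_space \<Rightarrow> 'v \<times> 'z \<Rightarrow> 'v \<times> 'z"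
  assumes "bilinear br"
  shows "J_map br Z X \<bullet> X' = (0, Z) \<bullet> br (X, 0) (X', 0)"
proof -
  let ?g = "\<lambda>X'. (0, Z) \<bullet> br (X, 0) (X', 0)"
  have l: "linear (br (X, 0))"
    using assms by (simp add: bilinear_def)
  have "linear ?g"
  proof (rule linearI)
    show "?g (a + b) = ?g a + ?g b" for a b
      using linear_add[OF l, of "(a, 0)" "(b, 0)"] by (simp add: inner_add_right)
    show "?g (c *\<^sub>R a) = c *\<^sub>R ?g a" for c a
      using linear_scale[OF l, of c "(a, 0)"] by simp
  qed
  then have "adjoint ?g 1 \<bullet> Y = ?g Y" for Y
    using adjoint_works[of ?g Y 1] by (simp add: inner_commute)
  then have "\<exists>!W. \<forall>Y. W \<bullet> Y = ?g Y"
    by (metis vector_eq_rdot)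
  then have "\<forall>Y. J_map br Z X \<bullet> Y = ?g Y"
    unfolding J_map_def by (rule theI')
  then show ?thesis
    by blast
qed

definition H_type ::
  "('v::euclidean_space \<times> 'z::euclidean_space \<Rightarrow> 'v \<times> 'z \<Rightarrow> 'v \<times> 'z) \<Rightarrow> bool" where
  "H_type br \<longleftrightarrow> lie_bracket br \<and> two_step_nilpotent br \<and> lie_centre br = {0} \<times> UNIV \<and>
     (\<forall>Z X. J_map br Z (J_map br Z X) = - ((norm Z)\<^sup>2 *\<^sub>R X))"


section \<open>The groups \<open>N\<close> and \<open>S = NA\<close>\<close>

text \<open>
  \<open>N\<close> is identified with its Lie algebra via \<open>exp\<close>, so that its product is given by the
  Baker--Campbell--Hausdorff formula, its neutral element is 0 and the inverse of \<open>n\<close> is \<open>- n\<close>.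
  Lebesgue measure on \<open>N\<close> is \<open>lborel\<close>.
\<close>

definition N_mult ::
  "('v::euclidean_space \<times> 'z::euclidean_space \<Rightarrow> 'v \<times> 'z \<Rightarrow> 'v \<times> 'z) \<Rightarrow> 'v \<times> 'z \<Rightarrow> 'v \<times> 'z \<Rightarrow> 'v \<times> 'z"
  where "N_mult br n n' = n + n' + (1/2) *\<^sub>R br n n'"

definition Q_dim :: "('v::euclidean_space \<times> 'z::euclidean_space) itself \<Rightarrow> real" where
  "Q_dim _ = real DIM('v) / 2 + real DIM('z)"

definition rho :: "('v::euclidean_space \<times> 'z::euclidean_space) itself \<Rightarrow> real" where
  "rho T = Q_dim T / 2"

text \<open>
  The element \<open>n a\<^sub>t\<close> of \<open>S\<close>, where \<open>a\<^sub>t = e\<^sup>t\<close>, is encoded as the pair \<open>(n, t)\<close>.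
\<close>

type_synonym ('v, 'z) DR = "('v \<times> 'z) \<times> real"

definition haar_S :: "('v::euclidean_space, 'z::euclidean_space) DR measure" where
  "haar_S = density lborel (\<lambda>(n, t). ennreal (exp (- 2 * rho TYPE('v \<times> 'z) * t)))"


section \<open>Poisson kernel and Fourier transform\<close>

definition poisson_profile :: "real \<Rightarrow> 'v::euclidean_space \<times> 'z::euclidean_space \<Rightarrow> real" where
  "poisson_profile t = (\<lambda>(V, Z). exp (t * Q_dim TYPE('v \<times> 'z)) *
     ((exp t + (norm V)\<^sup>2 / 4)\<^sup>2 + (norm Z)\<^sup>2) powr (- Q_dim TYPE('v \<times> 'z)))"

text \<open>
  By homogeneity under the dilations the integral of the profile does not depend on \<open>t\<close>, so a
  single constant normalises all \<open>P\<close> at once.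
\<close>

definition poisson_const :: "('v::euclidean_space \<times> 'z::euclidean_space) itself \<Rightarrow> real" where
  "poisson_const _ =
     (THE C. \<forall>t. (\<integral>n. C * poisson_profile t (n :: 'v \<times> 'z) \<partial>lborel) = 1)"

definition poisson :: "real \<Rightarrow> 'v::euclidean_space \<times> 'z::euclidean_space \<Rightarrow> real" where
  "poisson t n = poisson_const TYPE('v \<times> 'z) * poisson_profile t n"

definition poisson_S ::
  "('v::euclidean_space \<times> 'z::euclidean_space \<Rightarrow> 'v \<times> 'z \<Rightarrow> 'v \<times> 'z) \<Rightarrow>
     ('v, 'z) DR \<Rightarrow> 'v \<times> 'z \<Rightarrow> real" where
  "poisson_S br = (\<lambda>(n\<^sub>1, t) n. poisson t (N_mult br (- n) n\<^sub>1))"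

definition poisson_pow ::
  "('v::euclidean_space \<times> 'z::euclidean_space \<Rightarrow> 'v \<times> 'z \<Rightarrow> 'v \<times> 'z) \<Rightarrow>
     complex \<Rightarrow> ('v, 'z) DR \<Rightarrow> 'v \<times> 'z \<Rightarrow> complex" where
  "poisson_pow br \<zeta> x n =
     complex_of_real (poisson_S br x n) powr
       (1/2 - \<i> * \<zeta> / complex_of_real (Q_dim TYPE('v \<times> 'z)))"

text \<open>
  The Bochner integral is 0 when the integrand is not integrable; convergence of the integral has to
  be stated separately.
\<close>

definition fourier_converges ::
  "('v::euclidean_space \<times> 'z::euclidean_space \<Rightarrow> 'v \<times> 'z \<Rightarrow> 'v \<times> 'z) \<Rightarrow>
     (('v, 'z) DR \<Rightarrow> complex) \<Rightarrow> complex \<Rightarrow> 'v \<times> 'z \<Rightarrow> bool" where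
  "fourier_converges br f \<zeta> n \<longleftrightarrow> integrable haar_S (\<lambda>x. f x * poisson_pow br \<zeta> x n)"

definition fourier ::
  "('v::euclidean_space \<times> 'z::euclidean_space \<Rightarrow> 'v \<times> 'z \<Rightarrow> 'v \<times> 'z) \<Rightarrow>
     (('v, 'z) DR \<Rightarrow> complex) \<Rightarrow> complex \<Rightarrow> 'v \<times> 'z \<Rightarrow> complex" where
  "fourier br f \<zeta> n = (\<integral>x. f x * poisson_pow br \<zeta> x n \<partial>haar_S)"


section \<open>Norms\<close>

definition gamma_exp :: "ennreal \<Rightarrow> real" where
  "gamma_exp q = (if q = \<infinity> then - 1 else 2 / enn2real q - 1)"

definition ennreal_powr :: "ennreal \<Rightarrow> real \<Rightarrow> ennreal" where
  "ennreal_powr x a = (if x = \<infinity> then \<infinity> else ennreal (enn2real x powr a))"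

text \<open>
  The norm of \<open>L\<^sup>q(M)\<close> for \<open>1 \<le> q \<le> \<infinity>\<close>, with value \<open>\<infinity>\<close> if the function is not in \<open>L\<^sup>q(M)\<close>.
  Only meaningful for measurable \<open>g\<close>.
\<close>

definition Lq_norm :: "'a measure \<Rightarrow> ennreal \<Rightarrow> ('a \<Rightarrow> complex) \<Rightarrow> ennreal" where
  "Lq_norm M q g =
     (if q = \<infinity> then esssup M (\<lambda>x. ennreal (norm (g x)))
      else ennreal_powr (\<integral>\<^sup>+x. ennreal (norm (g x) powr enn2real q) \<partial>M) (1 / enn2real q))"

definition rearrangement :: "'a measure \<Rightarrow> ('a \<Rightarrow> complex) \<Rightarrow> real \<Rightarrow> ennreal" where
  "rearrangement M f t =
     Inf {s. emeasure M {x \<in> space M. ennreal (norm (f x)) > s} \<le> ennreal t}"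

definition weak_norm :: "'a measure \<Rightarrow> real \<Rightarrow> ('a \<Rightarrow> complex) \<Rightarrow> ennreal" where
  "weak_norm M p f = (SUP t\<in>{0<..}. ennreal (t powr (1 / p)) * rearrangement M f t)"

definition weak_Lp :: "'a measure \<Rightarrow> real \<Rightarrow> ('a \<Rightarrow> complex) set" where
  "weak_Lp M p = {f \<in> borel_measurable M. weak_norm M p f < \<infinity>}"

end

theory Submission
  imports Defs
begin

text \<open>
  On the line \<open>\<lambda> = \<alpha> + \<i> \<gamma>\<^sub>q \<rho>\<close> the kernel of the Fourier transform has modulus \<open>P(x, n) powr (1 / q)\<close>, so
  absolute values suffice: convergence and both norm estimates follow from bounds for the positive
  operator with this kernel, \<open>fourier_majorant\<close>. By duality (\<open>nn_integral_powr_le_by_duality\<close>) it suffices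
  to bound the bilinear form \<open>\<integral>\<integral> \<bar>f(x)\<bar> P(x, n) powr (1 / q) h(n) dx dn\<close> for \<open>h \<ge> 0\<close> in the unit ball of
  \<open>L\<^sup>q'(N)\<close>, where \<open>q' = q / (q - 1)\<close>.

  Part (i) is Young's inequality \<open>P powr (1 / q) * h \<le> P / q + h powr q' / q'\<close> together with the
  normalisation \<open>\<integral> P(x, n) dn = 1\<close> (\<open>pairing_L1_bound\<close>); the end points \<open>q = 1\<close> and \<open>q = \<infinity>\<close> are direct.

  For part (ii) let \<open>f\<close> have weak norm 1. Its values above 1 form an integrable function, covered by the
  same bound. Its values below 1 form a function in \<open>L\<^sup>r\<close> for every \<open>r > p\<close>, and \<open>r\<close> is chosen so close
  to \<open>p\<close> that \<open>r < q < r / (r - 1)\<close>. The bilinear form on \<open>L\<^sup>r(S) \<times> L\<^sup>q'(N)\<close> is critical: at each fixed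
  height \<open>t\<close> Young's convolution inequality on \<open>N\<close> gives a bound that is invariant under dilations, and
  nothing makes the integral over \<open>t\<close> converge. The remedy is to let the exponent vary. Write
  \<open>P = C exp (- t Q) D\<close>, where \<open>0 < D \<le> 1\<close> depends only on the dilated variable, and put
  \<open>v = exp (t Q) * h powr q'\<close>, which measures the size of \<open>h\<close> against the critical size at height \<open>t\<close>.
  Exponents on one side of \<open>q'\<close> give a gain where \<open>v\<close> is large, exponents on the other side where \<open>v\<close> is
  small. Both gains are expressed by the factor \<open>tent \<kappa> v = min (v powr \<kappa>) (v powr (- \<kappa>))\<close> in the
  pointwise inequality

  \<open>F powr (1 / r) * v powr (1 / q') * D powr (1 / q)
    \<le> F * D powr \<theta> + F * (v * tent \<kappa> v) + v * tent \<kappa> v * D powr \<theta>\<close>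

  for \<open>F = \<bar>f\<bar> powr r\<close> (\<open>interpolation_inequality\<close>). Each term on the right can be integrated by Tonelli's
  theorem. Two facts make the integrals finite: \<open>D powr \<theta>\<close> is integrable over \<open>N\<close> for \<open>\<theta> > 1 / 2\<close>
  (\<open>nn_integral_scaled_kernel_finite\<close>), which is possible because \<open>q < r / (r - 1)\<close>; and the integral of
  the tent over \<open>t\<close> is a constant independent of \<open>h\<close> (\<open>nn_integral_tent\<close>), where \<open>\<kappa> > 0\<close> is possible
  because \<open>r < q\<close>.
\<close>

section \<open>Elementary integrals on Euclidean spaces\<close>

lemma nn_integral_even_le:
  fixes f :: "real \<Rightarrow> ennreal"
  assumes [measurable]: "f \<in> borel_measurable borel" and even: "\<And>x. f (- x) = f x"
  shows "(\<integral>\<^sup>+x. f x \<partial>lborel) \<le> 2 * (\<integral>\<^sup>+x. f x * indicator {0..} x \<partial>lborel)"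
proof -
  have "(\<integral>\<^sup>+x. f x \<partial>lborel) \<le> (\<integral>\<^sup>+x. f x * indicator {0..} x + f x * indicator {0..} (- x) \<partial>lborel)"
    by (intro nn_integral_mono) (auto simp: indicator_def)
  also have "\<dots> = (\<integral>\<^sup>+x. f x * indicator {0..} x \<partial>lborel) + (\<integral>\<^sup>+x. f x * indicator {0..} (- x) \<partial>lborel)"
    by (intro nn_integral_add) auto
  also have "(\<integral>\<^sup>+x. f x * indicator {0..} (- x) \<partial>lborel) = (\<integral>\<^sup>+x. f x * indicator {0..} x \<partial>lborel)"
    by (subst nn_integral_real_affine[where c="-1" and t=0]) (auto simp: even)
  finally show ?thesis by (simp add: mult_2)
qed

lemma nn_integral_exp_minus_abs_finite:
  fixes c :: real
  assumes "c > 0"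
  shows "(\<integral>\<^sup>+t. ennreal (exp (- c * \<bar>t\<bar>)) \<partial>lborel) < \<infinity>"
proof -
  have "(\<integral>\<^sup>+t. ennreal (exp (- c * \<bar>t\<bar>)) \<partial>lborel)
      \<le> 2 * (\<integral>\<^sup>+t. ennreal (exp (- c * \<bar>t\<bar>)) * indicator {0..} t \<partial>lborel)"
    by (intro nn_integral_even_le) auto
  also have "(\<integral>\<^sup>+t. ennreal (exp (- c * \<bar>t\<bar>)) * indicator {0..} t \<partial>lborel)
      = (\<integral>\<^sup>+t. ennreal (exp (- c * t)) * indicator {0..} t \<partial>lborel)"
    by (intro nn_integral_cong) (auto simp: indicator_def)
  also have "\<dots> = ennreal (0 - (- exp (- c * 0) / c))"
  proof (rule nn_integral_FTC_atLeast)
    show "((\<lambda>t. - exp (- c * t) / c) \<longlongrightarrow> 0) at_top"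
    proof -
      have "filterlim (\<lambda>t. c * t) at_top at_top"
        using assms by (intro filterlim_tendsto_pos_mult_at_top[OF tendsto_const]) (auto simp: filterlim_ident)
      then have "((\<lambda>t. exp (- (c * t))) \<longlongrightarrow> 0) at_top"
        by (intro filterlim_compose[OF exp_at_bot]) (auto simp: filterlim_uminus_at_bot)
      from tendsto_mult[OF tendsto_const[of "- (1 / c)"] this] show ?thesis by simp
    qed
    show "DERIV (\<lambda>t. - exp (- c * t) / c) t :> exp (- c * t)" for t
      using assms by (auto intro!: derivative_eq_intros)
  qed auto
  finally show ?thesis
    by (auto simp: ennreal_mult_less_top less_top[symmetric] top_unique ennreal_mult_eq_top_iff)
qed

lemma nn_integral_bracket_powr_real_finite:
  fixes a :: real
  assumes "a > 1/2"
  shows "(\<integral>\<^sup>+x. ennreal ((1 + x\<^sup>2) powr (- a)) \<partial>lborel) < \<infinity>"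
proof -
  have *: "(1 + x\<^sup>2) powr (- a) \<le> 2 powr a * (1 + x) powr (- (2 * a))" if "x \<ge> 0" for x :: real
  proof -
    have "(1 + x)\<^sup>2 / 2 \<le> 1 + x\<^sup>2"
      using zero_le_power2[of "x - 1"] by (simp add: power2_eq_square algebra_simps)
    then have "(1 + x\<^sup>2) powr (- a) \<le> ((1 + x)\<^sup>2 / 2) powr (- a)"
      using assms that by (intro powr_mono2') auto
    also have "\<dots> = 2 powr a * (1 + x) powr (- (2 * a))"
      using that by (simp add: powr_divide powr_minus divide_simps powr_powr[symmetric])
    finally show ?thesis .
  qed
  have "(\<integral>\<^sup>+x. ennreal ((1 + x\<^sup>2) powr (- a)) \<partial>lborel)
      \<le> 2 * (\<integral>\<^sup>+x. ennreal ((1 + x\<^sup>2) powr (- a)) * indicator {0..} x \<partial>lborel)"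
    by (intro nn_integral_even_le) auto
  also have "\<dots> \<le> 2 * (\<integral>\<^sup>+x. ennreal (2 powr a * (1 + x) powr (- (2 * a))) * indicator {0..} x \<partial>lborel)"
    using * by (intro mult_left_mono nn_integral_mono) (auto simp: indicator_def intro!: ennreal_leI)
  also have "(\<integral>\<^sup>+x. ennreal (2 powr a * (1 + x) powr (- (2 * a))) * indicator {0..} x \<partial>lborel)
      = ennreal (0 - (2 powr a * ((1 + 0) powr (1 - 2 * a) / (1 - 2 * a))))"
  proof (rule nn_integral_FTC_atLeast)
    have "((\<lambda>x::real. (1 + x) powr (1 - 2 * a)) \<longlongrightarrow> 0) at_top"
    proof (rule tendsto_neg_powr)
      show "1 - 2 * a < 0" using assms by simp
      show "filterlim (\<lambda>x::real. 1 + x) at_top at_top"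
        by (rule filterlim_tendsto_add_at_top[OF tendsto_const filterlim_ident])
    qed
    from tendsto_mult[OF tendsto_const[of "2 powr a / (1 - 2 * a)"] this]
    show "((\<lambda>x::real. 2 powr a * ((1 + x) powr (1 - 2 * a) / (1 - 2 * a))) \<longlongrightarrow> 0) at_top"
      by simp
    show "DERIV (\<lambda>x. 2 powr a * ((1 + x) powr (1 - 2 * a) / (1 - 2 * a))) x :> 2 powr a * (1 + x) powr (- (2 * a))"
      if "0 \<le> x" for x
      using assms that by (auto intro!: derivative_eq_intros)
  qed auto
  finally show ?thesis
    by (auto simp: ennreal_mult_less_top less_top[symmetric] top_unique ennreal_mult_eq_top_iff)
qed

lemma bracket_prod_le:
  fixes x :: "'a::euclidean_space"
  shows "(\<Prod>b\<in>Basis. (1 + (x \<bullet> b)\<^sup>2)) \<le> (1 + (norm x)\<^sup>2) ^ DIM('a)"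
proof -
  have "(x \<bullet> b)\<^sup>2 \<le> (norm x)\<^sup>2" if "b \<in> Basis" for b
    using Basis_le_norm[OF that, of x] by (metis abs_ge_zero power2_abs power_mono)
  then have "(\<Prod>b\<in>Basis. (1 + (x \<bullet> b)\<^sup>2)) \<le> (\<Prod>b\<in>(Basis::'a set). (1 + (norm x)\<^sup>2))"
    by (intro prod_mono) auto
  then show ?thesis by simp
qed

text \<open>
  The product bound dominates the integrand by a tensor product of functions
  \<open>(1 + x\<^sup>2) powr (- s / d)\<close>; in each coordinate the exponent condition becomes \<open>s / d > 1 / 2\<close>,
  so the sharp range of \<open>s\<close> is already reached in dimension one.
\<close>

lemma nn_integral_bracket_powr_finite:
  fixes s :: real
  assumes "s > real DIM('a) / 2"
  shows "(\<integral>\<^sup>+x. ennreal ((1 + (norm (x::'a::euclidean_space))\<^sup>2) powr (- s)) \<partial>lborel) < \<infinity>"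
proof -
  define a where "a = s / DIM('a)"
  have a: "a > 1/2" using assms by (simp add: a_def field_simps)
  have *: "(1 + (norm x)\<^sup>2) powr (- s) \<le> (\<Prod>b\<in>Basis. (1 + (x \<bullet> b)\<^sup>2) powr (- a))" for x :: 'a
  proof -
    have "(1 + (norm x)\<^sup>2) powr (- s) = ((1 + (norm x)\<^sup>2) ^ DIM('a)) powr (- a)"
      by (subst powr_realpow[symmetric]) (auto simp: powr_powr a_def add_pos_nonneg)
    also have "\<dots> \<le> (\<Prod>b\<in>Basis. (1 + (x \<bullet> b)\<^sup>2)) powr (- a)"
      using a by (intro powr_mono2' bracket_prod_le prod_pos) (auto simp: add_pos_nonneg)
    also have "\<dots> = (\<Prod>b\<in>Basis. (1 + (x \<bullet> b)\<^sup>2) powr (- a))"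
      by (rule prod_powr_distrib)
    finally show ?thesis .
  qed
  have "(\<integral>\<^sup>+x. ennreal ((1 + (norm (x::'a))\<^sup>2) powr (- s)) \<partial>lborel)
      \<le> (\<integral>\<^sup>+x. (\<Prod>b\<in>Basis. ennreal ((1 + ((x::'a) \<bullet> b)\<^sup>2) powr (- a))) \<partial>lborel)"
    using * by (intro nn_integral_mono) (auto simp: prod_ennreal intro!: ennreal_leI)
  also have "\<dots> = (\<Prod>b\<in>(Basis::'a set). (\<integral>\<^sup>+x. ennreal ((1 + x\<^sup>2) powr (- a)) \<partial>lborel))"
    by (rule nn_integral_lborel_prod) auto
  also have "\<dots> < \<infinity>"
    using nn_integral_bracket_powr_real_finite[OF a] by (simp add: power_less_top_ennreal)
  finally show ?thesis .
qed

section \<open>Invariant integration on the group \<open>N\<close>\<close>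

lemma nn_integral_lborel_translate_reflect:
  fixes a :: "'a::euclidean_space" and c :: real
  assumes [measurable]: "g \<in> borel_measurable borel" and c: "\<bar>c\<bar> = 1"
  shows "(\<integral>\<^sup>+x. g (a + c *\<^sub>R x) \<partial>lborel) = (\<integral>\<^sup>+x. g x \<partial>lborel)"
proof -
  have "c \<noteq> 0" using c by auto
  have "(\<integral>\<^sup>+x. g x \<partial>lborel) = (\<integral>\<^sup>+x. g x \<partial>density (distr lborel borel (\<lambda>x. a + c *\<^sub>R x)) (\<lambda>_. ennreal (\<bar>c\<bar> ^ DIM('a))))"
    using lborel_affine[OF \<open>c \<noteq> 0\<close>, of a] by simp
  also have "\<dots> = (\<integral>\<^sup>+x. g (a + c *\<^sub>R x) \<partial>lborel)"
    using c by (simp add: nn_integral_density nn_integral_distr)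
  finally show ?thesis ..
qed

lemma nn_integral_lborel_scale:
  fixes c :: real
  assumes [measurable]: "g \<in> borel_measurable borel" and c: "c > 0"
  shows "(\<integral>\<^sup>+x. g x \<partial>lborel) = ennreal (c ^ DIM('a)) * (\<integral>\<^sup>+x. g (c *\<^sub>R (x::'a::euclidean_space)) \<partial>lborel)"
proof -
  have "(\<integral>\<^sup>+x. g x \<partial>lborel) = (\<integral>\<^sup>+x. g x \<partial>density (distr lborel borel (\<lambda>x. 0 + c *\<^sub>R (x::'a))) (\<lambda>_. ennreal (\<bar>c\<bar> ^ DIM('a))))"
    using lborel_affine[of c "0::'a"] c by simp
  also have "\<dots> = ennreal (c ^ DIM('a)) * (\<integral>\<^sup>+x. g (c *\<^sub>R (x::'a)) \<partial>lborel)"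
    using c by (simp add: nn_integral_density nn_integral_distr nn_integral_cmult)
  finally show ?thesis .
qed

lemma borel_measurable_fst_borel [measurable]:
  "fst \<in> borel_measurable (borel :: ('a::topological_space \<times> 'b::topological_space) measure)"
  by (intro borel_measurable_continuous_onI continuous_intros)

lemma borel_measurable_snd_borel [measurable]:
  "snd \<in> borel_measurable (borel :: ('a::topological_space \<times> 'b::topological_space) measure)"
  by (intro borel_measurable_continuous_onI continuous_intros)

lemma lborel_pair_measurable:
  fixes g :: "'a::euclidean_space \<times> 'b::euclidean_space \<Rightarrow> ennreal"
  assumes "g \<in> borel_measurable borel"
  shows "g \<in> borel_measurable (lborel \<Otimes>\<^sub>M lborel)"
  using assms by (simp add: lborel_prod)

lemma nn_integral_lborel_pair:
  fixes g :: "'a::euclidean_space \<times> 'b::euclidean_space \<Rightarrow> ennreal"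
  assumes "g \<in> borel_measurable borel"
  shows "(\<integral>\<^sup>+n. g n \<partial>lborel) = (\<integral>\<^sup>+x. (\<integral>\<^sup>+y. g (x, y) \<partial>lborel) \<partial>lborel)"
  using lborel.nn_integral_fst[OF lborel_pair_measurable[OF assms]] by (simp add: lborel_prod)

lemma borel_measurable_nn_integral_pair:
  fixes g :: "'a::euclidean_space \<times> 'b::euclidean_space \<Rightarrow> ennreal"
  assumes "g \<in> borel_measurable borel"
  shows "(\<lambda>x. \<integral>\<^sup>+y. g (x, y) \<partial>lborel) \<in> borel_measurable borel"
  using lborel.borel_measurable_nn_integral_fst[OF lborel_pair_measurable[OF assms]] by simp

text \<open>
  Tonelli: for a fixed first coordinate the second one is only translated or reflected.
\<close>

lemma nn_integral_shear:
  fixes g :: "'a::euclidean_space \<times> 'b::euclidean_space \<Rightarrow> ennreal"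
  assumes [measurable]: "g \<in> borel_measurable borel" "b \<in> borel_measurable borel" and "\<bar>c\<bar> = 1" "\<bar>d\<bar> = 1"
  shows "(\<integral>\<^sup>+n. g (a + c *\<^sub>R fst n, b (fst n) + d *\<^sub>R snd n) \<partial>lborel) = (\<integral>\<^sup>+n. g n \<partial>lborel)"
proof -
  note [measurable] = borel_measurable_nn_integral_pair[OF assms(1)]
  have "(\<integral>\<^sup>+n. g (a + c *\<^sub>R fst n, b (fst n) + d *\<^sub>R snd n) \<partial>lborel)
      = (\<integral>\<^sup>+x. (\<integral>\<^sup>+y. g (a + c *\<^sub>R x, b x + d *\<^sub>R y) \<partial>lborel) \<partial>lborel)"
    by (subst nn_integral_lborel_pair) auto
  also have "\<dots> = (\<integral>\<^sup>+x. (\<integral>\<^sup>+y. g (a + c *\<^sub>R x, y) \<partial>lborel) \<partial>lborel)"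
    using assms by (intro nn_integral_cong nn_integral_lborel_translate_reflect[where g="\<lambda>y. g (_, y)"]) auto
  also have "\<dots> = (\<integral>\<^sup>+x. (\<integral>\<^sup>+y. g (x, y) \<partial>lborel) \<partial>lborel)"
    using assms by (intro nn_integral_lborel_translate_reflect[where g="\<lambda>x. \<integral>\<^sup>+y. g (x, y) \<partial>lborel"]) auto
  also have "\<dots> = (\<integral>\<^sup>+n. g n \<partial>lborel)"
    by (rule nn_integral_lborel_pair[symmetric]) auto
  finally show ?thesis .
qed

lemma H_type_bilinear: "H_type br \<Longrightarrow> bilinear br"
  by (simp add: H_type_def lie_bracket_def)

text \<open>
  Brackets are central because the algebra is two-step nilpotent, and the centre is \<open>{0} \<times> UNIV\<close>, so a
  bracket neither has a component in \<open>'v\<close> nor depends on the central components of its arguments.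
  Translations of \<open>N\<close> are therefore shears of the Euclidean space \<open>'v \<times> 'z\<close>.
\<close>

lemma H_type_bracket:
  fixes br :: "'v::euclidean_space \<times> 'z::euclidean_space \<Rightarrow> 'v \<times> 'z \<Rightarrow> 'v \<times> 'z"
  assumes H: "H_type br"
  shows "br n n' = (0, snd (br (fst n, 0) (fst n', 0)))"
proof -
  note bil = H_type_bilinear[OF H]
  have central: "br (0, Z) x = 0" for Z x
  proof -
    have "(0, Z) \<in> lie_centre br" using H by (simp add: H_type_def)
    then show ?thesis by (cases x) (simp add: lie_centre_def)
  qed
  have anti: "br x y = - br y x" for x y
  proof -
    have alt: "br w w = 0" for w using H by (simp add: H_type_def lie_bracket_def del: split_paired_All)
    have "br (x + y) (x + y) = (br x x + br y x) + (br x y + br y y)"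
      by (simp only: bilinear_ladd[OF bil] bilinear_radd[OF bil])
    then have "br x y + br y x = 0" by (simp add: alt add.commute)
    then show ?thesis by (simp add: eq_neg_iff_add_eq_0)
  qed
  have central': "br x (0, Z) = 0" for Z x using anti[of x "(0, Z)"] central by simp
  have "\<forall>w. br (br x y) w = 0" for x y
    using H unfolding H_type_def two_step_nilpotent_def by blast
  then have "br x y \<in> lie_centre br" for x y
    unfolding lie_centre_def by blast
  moreover have "lie_centre br = {0} \<times> UNIV"
    using H by (simp add: H_type_def)
  ultimately have "fst (br x y) = 0" for x y
    by (metis mem_Times_iff singletonD)
  moreover have "br n n' = br (fst n, 0) (fst n', 0)"
  proof -
    have "n = (fst n, 0) + (0, snd n)" "n' = (fst n', 0) + (0, snd n')" by (auto simp: prod_eq_iff)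
    then have "br n n' = br ((fst n, 0) + (0, snd n)) ((fst n', 0) + (0, snd n'))" by simp
    also have "\<dots> = br (fst n, 0) (fst n', 0)"
      by (simp only: bilinear_ladd[OF bil] bilinear_radd[OF bil] central central') simp
    finally show ?thesis .
  qed
  ultimately show ?thesis by (metis prod.collapse)
qed

lemma bilinear_continuous_on:
  fixes br :: "'a::euclidean_space \<Rightarrow> 'b::euclidean_space \<Rightarrow> 'c::real_normed_vector"
  assumes "bilinear br" "continuous_on S f" "continuous_on S g"
  shows "continuous_on S (\<lambda>x. br (f x) (g x))"
proof -
  have "bounded_bilinear br" using assms(1) by (simp add: bilinear_conv_bounded_bilinear)
  then show ?thesis by (rule bounded_bilinear.continuous_on) (fact assms)+
qed

lemma measurable_N_mult:
  assumes H: "H_type br" and [measurable]: "f \<in> borel_measurable M" "g \<in> borel_measurable M"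
  shows "(\<lambda>x. N_mult br (f x) (g x)) \<in> borel_measurable M"
proof -
  have "continuous_on UNIV (\<lambda>z. N_mult br (fst z) (snd z))"
    unfolding N_mult_def
    by (intro continuous_intros bilinear_continuous_on[OF H_type_bilinear[OF H]])
  then have "(\<lambda>z. N_mult br (fst z) (snd z)) \<in> borel_measurable borel"
    by (rule borel_measurable_continuous_onI)
  from measurable_compose[OF _ this, of "\<lambda>x. (f x, g x)" M] show ?thesis
    by simp
qed

lemma N_mult_conv_shear:
  assumes H: "H_type br"
  shows "N_mult br (- n) n1 = (fst n1 + (-1) *\<^sub>R fst n,
           (snd n1 - (1/2) *\<^sub>R snd (br (fst n, 0) (fst n1, 0))) + (-1) *\<^sub>R snd n)"
proof -
  have "br (- n) n1 = - br n n1" by (rule bilinear_lneg[OF H_type_bilinear[OF H]])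
  then show ?thesis
    unfolding N_mult_def by (subst (asm) H_type_bracket[OF H, of n]) (auto simp: prod_eq_iff)
qed

text \<open>
  Lebesgue measure is a Haar measure of the unimodular group \<open>N\<close>, hence invariant under inversion and
  under translations. Concretely, both maps in the next two facts are shears.
\<close>

lemma nn_integral_N_mult_left:
  assumes H: "H_type br" and [measurable]: "g \<in> borel_measurable borel"
  shows "(\<integral>\<^sup>+n. g (N_mult br (- n) n1) \<partial>lborel) = (\<integral>\<^sup>+n. g n \<partial>lborel)"
proof -
  have "(\<lambda>x. snd n1 - (1/2) *\<^sub>R snd (br (x, 0) (fst n1, 0))) \<in> borel_measurable borel"
    by (intro borel_measurable_continuous_onI continuous_intros bilinear_continuous_on[OF H_type_bilinear[OF H]])
  from nn_integral_shear[OF assms(2) this, of "-1" "-1" "fst n1"] show ?thesis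
    unfolding N_mult_conv_shear[OF H] by simp
qed

lemma nn_integral_N_mult_right:
  assumes H: "H_type br" and [measurable]: "g \<in> borel_measurable borel"
  shows "(\<integral>\<^sup>+n1. g (N_mult br (- n) n1) \<partial>lborel) = (\<integral>\<^sup>+n. g n \<partial>lborel)"
proof -
  have "(\<lambda>x. - snd n - (1/2) *\<^sub>R snd (br (fst n, 0) (x, 0))) \<in> borel_measurable borel"
    by (intro borel_measurable_continuous_onI continuous_intros bilinear_continuous_on[OF H_type_bilinear[OF H]])
  from nn_integral_shear[OF assms(2) this, of 1 1 "- fst n"] show ?thesis
    unfolding N_mult_conv_shear[OF H] by (simp add: algebra_simps)
qed

section \<open>The Poisson kernel\<close>

text \<open>
  The Poisson kernel \<open>P\<^sub>t\<close> is \<open>exp (- t Q)\<close> times this function, up to the normalising constant. This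
  normalisation makes the kernel a function of the dilated variable only, with values in \<open>(0, 1]\<close>: it
  has size comparable to 1 on a ball of measure about \<open>exp (t Q)\<close> and decays outside of it.
\<close>

definition scaled_kernel :: "real \<Rightarrow> 'v::euclidean_space \<times> 'z::euclidean_space \<Rightarrow> real" where
  "scaled_kernel t n = exp (t * Q_dim TYPE('v \<times> 'z)) * poisson_profile t n"

lemma Q_dim_pos: "0 < Q_dim TYPE('v::euclidean_space \<times> 'z::euclidean_space)"
  by (simp add: Q_dim_def add_pos_pos)

lemma scaled_kernel_eq:
  fixes n :: "'v::euclidean_space \<times> 'z::euclidean_space"
  shows "scaled_kernel t n = exp (2 * t * Q_dim TYPE('v \<times> 'z)) *
     ((exp t + (norm (fst n))\<^sup>2 / 4)\<^sup>2 + (norm (snd n))\<^sup>2) powr (- Q_dim TYPE('v \<times> 'z))"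
  by (simp add: scaled_kernel_def poisson_profile_def case_prod_beta mult_exp_exp algebra_simps)

lemma kernel_base_pos: "0 < (exp t + (norm V)\<^sup>2 / 4)\<^sup>2 + (norm Z)\<^sup>2" for t :: real
  by (intro add_pos_nonneg zero_less_power) auto

lemma scaled_kernel_pos [simp]: "0 < scaled_kernel t n"
  unfolding scaled_kernel_eq
  by (intro mult_pos_pos exp_gt_zero powr_gt_zero[THEN iffD2] less_imp_neq[THEN not_sym] kernel_base_pos)

lemma scaled_kernel_nonneg [simp]: "0 \<le> scaled_kernel t n"
  by (rule less_imp_le) simp

lemma scaled_kernel_le_1:
  fixes n :: "'v::euclidean_space \<times> 'z::euclidean_space"
  shows "scaled_kernel t n \<le> 1"
proof -
  let ?B = "(exp t + (norm (fst n))\<^sup>2 / 4)\<^sup>2 + (norm (snd n))\<^sup>2"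
  let ?Q = "Q_dim TYPE('v \<times> 'z)"
  have "(exp t)\<^sup>2 \<le> (exp t + (norm (fst n))\<^sup>2 / 4)\<^sup>2"
    by (intro power_mono) auto
  then have "(exp t)\<^sup>2 \<le> ?B" by (simp add: add_increasing2)
  then have "?B powr (- ?Q) \<le> ((exp t)\<^sup>2) powr (- ?Q)"
    using Q_dim_pos[where 'v='v and 'z='z] by (intro powr_mono2') auto
  also have "\<dots> = exp (- (2 * t * ?Q))"
    by (simp add: powr_def ln_realpow algebra_simps)
  finally show ?thesis
    by (simp add: scaled_kernel_eq exp_minus field_simps)
qed

lemma scaled_kernel_measurable [measurable]:
  fixes f :: "'a \<Rightarrow> real" and g :: "'a \<Rightarrow> 'v::euclidean_space \<times> 'z::euclidean_space"
  assumes [measurable]: "f \<in> borel_measurable M" "g \<in> borel_measurable M"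
  shows "(\<lambda>x. scaled_kernel (f x) (g x)) \<in> borel_measurable M"
proof -
  have [measurable]: "(\<lambda>x. fst (g x)) \<in> borel_measurable M" "(\<lambda>x. snd (g x)) \<in> borel_measurable M"
    using measurable_compose[OF assms(2) borel_measurable_fst_borel]
      measurable_compose[OF assms(2) borel_measurable_snd_borel] by auto
  show ?thesis unfolding scaled_kernel_eq by measurable
qed

text \<open>
  The dilation by \<open>exp t\<close> scales \<open>'v\<close> by \<open>exp (t / 2)\<close> and \<open>'z\<close> by \<open>exp t\<close>, so its Jacobian is
  \<open>exp (t Q)\<close>; this is the origin of the homogeneous dimension \<open>Q\<close> in all integrals below.
\<close>

lemma scaled_kernel_dilate:
  "scaled_kernel t (exp (t/2) *\<^sub>R V, exp t *\<^sub>R Z) = scaled_kernel 0 (V, Z)"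
proof -
  let ?B = "(1 + (norm V)\<^sup>2 / 4)\<^sup>2 + (norm Z)\<^sup>2"
  have B: "0 < ?B" using kernel_base_pos[of 0 V Z] by simp
  have e: "(exp (t/2))\<^sup>2 = exp t"
    by (simp add: exp_double[symmetric])
  have "(exp t + (norm (exp (t/2) *\<^sub>R V))\<^sup>2 / 4)\<^sup>2 + (norm (exp t *\<^sub>R Z))\<^sup>2 = (exp t)\<^sup>2 * ?B"
    by (simp add: power_mult_distrib e) (simp add: power2_eq_square algebra_simps)
  moreover have "((exp t)\<^sup>2 * ?B) powr a = exp (2 * t * a) * ?B powr a" for a
    using B by (subst powr_mult) (auto simp: powr_def ln_realpow mult_ac)
  ultimately show ?thesis
    by (simp add: scaled_kernel_eq exp_minus)
qed

lemma nn_integral_scaled_kernel: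
  "(\<integral>\<^sup>+n. ennreal (scaled_kernel t (n::'v::euclidean_space \<times> 'z::euclidean_space) powr \<theta>) \<partial>lborel)
     = ennreal (exp (t * Q_dim TYPE('v \<times> 'z))) * (\<integral>\<^sup>+n. ennreal (scaled_kernel 0 (n::'v \<times> 'z) powr \<theta>) \<partial>lborel)"
proof -
  let ?K = "\<lambda>t (n::'v \<times> 'z). ennreal (scaled_kernel t n powr \<theta>)"
  have m: "?K t \<in> borel_measurable borel" for t by measurable
  have m1: "(\<lambda>Z. ?K t (V, Z)) \<in> borel_measurable borel" for t V by measurable
  note m2 = borel_measurable_nn_integral_pair[OF m]
  have "(\<integral>\<^sup>+n. ?K t n \<partial>lborel) = (\<integral>\<^sup>+V. (\<integral>\<^sup>+Z. ?K t (V, Z) \<partial>lborel) \<partial>lborel)"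
    by (rule nn_integral_lborel_pair[OF m])
  also have "\<dots> = ennreal (exp (t/2) ^ DIM('v)) * (\<integral>\<^sup>+V. (\<integral>\<^sup>+Z. ?K t (exp (t/2) *\<^sub>R V, Z) \<partial>lborel) \<partial>lborel)"
    by (rule nn_integral_lborel_scale[OF m2]) simp
  also have "(\<lambda>V. \<integral>\<^sup>+Z. ?K t (exp (t/2) *\<^sub>R V, Z) \<partial>lborel)
      = (\<lambda>V. ennreal (exp t ^ DIM('z)) * (\<integral>\<^sup>+Z. ?K 0 (V, Z) \<partial>lborel))"
    by (subst nn_integral_lborel_scale[OF m1, of "exp t"]) (simp_all add: scaled_kernel_dilate)
  also have "(\<integral>\<^sup>+V. ennreal (exp t ^ DIM('z)) * (\<integral>\<^sup>+Z. ?K 0 (V, Z) \<partial>lborel) \<partial>lborel)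
      = ennreal (exp t ^ DIM('z)) * (\<integral>\<^sup>+V. (\<integral>\<^sup>+Z. ?K 0 (V, Z) \<partial>lborel) \<partial>lborel)"
    by (rule nn_integral_cmult) (use m2 in simp)
  also have "(\<integral>\<^sup>+V. (\<integral>\<^sup>+Z. ?K 0 (V, Z) \<partial>lborel) \<partial>lborel) = (\<integral>\<^sup>+n. ?K 0 n \<partial>lborel)"
    by (rule nn_integral_lborel_pair[OF m, symmetric])
  also have "ennreal (exp (t/2) ^ DIM('v)) * (ennreal (exp t ^ DIM('z)) * (\<integral>\<^sup>+n. ?K 0 n \<partial>lborel))
      = ennreal (exp (t * Q_dim TYPE('v \<times> 'z))) * (\<integral>\<^sup>+n. ?K 0 n \<partial>lborel)"
    by (simp add: mult.assoc[symmetric] ennreal_mult[symmetric] exp_of_nat_mult[symmetric] mult_exp_exp Q_dim_def algebra_simps)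
  finally show ?thesis .
qed

text \<open>
  The kernel decays like the power \<open>- 4 Q\<close> of \<open>norm V\<close> and like the power \<open>- 2 Q\<close> of \<open>norm Z\<close>. Its
  exponent \<open>E = Q \<theta>\<close> can be divided into \<open>x + z\<close>, with \<open>4 x\<close> larger than the dimension of \<open>'v\<close> and
  \<open>2 z\<close> larger than that of \<open>'z\<close>, precisely when \<open>2 E > Q\<close>; then the kernel is dominated by an
  integrable tensor product.
\<close>

lemma nn_integral_scaled_kernel_finite:
  assumes "\<theta> > 1/2"
  shows "(\<integral>\<^sup>+n. ennreal (scaled_kernel 0 (n::'v::euclidean_space \<times> 'z::euclidean_space) powr \<theta>) \<partial>lborel) < \<infinity>"
proof -
  define E where "E = Q_dim TYPE('v \<times> 'z) * \<theta>"
  define \<eta> where "\<eta> = 2 * E - Q_dim TYPE('v \<times> 'z)"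
  have "\<eta> > 0" using assms Q_dim_pos[where 'v='v and 'z='z] by (simp add: \<eta>_def E_def field_simps)
  define x z where "x = (DIM('v) + \<eta>) / 4" and "z = DIM('z) / 2 + \<eta> / 4"
  have E: "E = x + z" by (simp add: x_def z_def \<eta>_def Q_dim_def field_simps)
  have pos: "0 < x" "0 < z" using \<open>\<eta> > 0\<close> by (auto simp: x_def z_def add_pos_pos)
  have *: "scaled_kernel 0 (V, Z) powr \<theta> \<le> ((1/4) powr (- (2 * x)) * (1 + (norm V)\<^sup>2) powr (- (2 * x))) * (1 + (norm Z)\<^sup>2) powr (- z)"
    for V :: 'v and Z :: 'z
  proof -
    let ?B = "(1 + (norm V)\<^sup>2 / 4)\<^sup>2 + (norm Z)\<^sup>2"
    have B: "0 < ?B" using kernel_base_pos[of 0 V Z] by simp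
    have "(1::real)\<^sup>2 \<le> (1 + (norm V)\<^sup>2 / 4)\<^sup>2" by (intro power_mono) auto
    then have B1: "1 + (norm Z)\<^sup>2 \<le> ?B" by simp
    have "((1 + (norm V)\<^sup>2) / 4)\<^sup>2 \<le> (1 + (norm V)\<^sup>2 / 4)\<^sup>2" by (intro power_mono) auto
    then have B2: "((1 + (norm V)\<^sup>2) / 4)\<^sup>2 \<le> ?B" by (simp add: add_increasing2)
    have p: "0 < 1 + (norm V)\<^sup>2" "0 < 1 + (norm Z)\<^sup>2" by (auto intro: add_pos_nonneg)
    have "scaled_kernel 0 (V, Z) powr \<theta> = ?B powr (- x) * ?B powr (- z)"
      using B by (simp add: scaled_kernel_eq powr_powr powr_add[symmetric] E_def[symmetric] E)
    also have "\<dots> \<le> (((1 + (norm V)\<^sup>2) / 4)\<^sup>2) powr (- x) * (1 + (norm Z)\<^sup>2) powr (- z)"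
      using B1 B2 p pos by (intro mult_mono powr_mono2') (auto simp del: power_divide)
    also have "(((1 + (norm V)\<^sup>2) / 4)\<^sup>2) powr (- x) = ((1 + (norm V)\<^sup>2) / 4) powr (- (2 * x))"
      using p by (simp add: powr_def ln_realpow del: power_divide)
    also have "\<dots> = (1/4) powr (- (2 * x)) * (1 + (norm V)\<^sup>2) powr (- (2 * x))"
      using p by (subst powr_mult[symmetric]) auto
    finally show ?thesis .
  qed
  have "(\<integral>\<^sup>+n. ennreal (scaled_kernel 0 (n::'v \<times> 'z) powr \<theta>) \<partial>lborel)
      = (\<integral>\<^sup>+V. \<integral>\<^sup>+Z. ennreal (scaled_kernel 0 (V::'v, Z::'z) powr \<theta>) \<partial>lborel \<partial>lborel)"
    by (rule nn_integral_lborel_pair) measurable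
  also have "\<dots> \<le> (\<integral>\<^sup>+V. \<integral>\<^sup>+Z. ennreal ((1/4) powr (- (2 * x)) * (1 + (norm (V::'v))\<^sup>2) powr (- (2 * x)))
        * ennreal ((1 + (norm (Z::'z))\<^sup>2) powr (- z)) \<partial>lborel \<partial>lborel)"
    using * by (intro nn_integral_mono) (auto simp: ennreal_mult[symmetric] intro!: ennreal_leI)
  also have "\<dots> = ennreal ((1/4) powr (- (2 * x))) * (\<integral>\<^sup>+V. ennreal ((1 + (norm (V::'v))\<^sup>2) powr (- (2 * x))) \<partial>lborel)
      * (\<integral>\<^sup>+Z. ennreal ((1 + (norm (Z::'z))\<^sup>2) powr (- z)) \<partial>lborel)"
    by (simp add: nn_integral_cmult nn_integral_multc ennreal_mult)
  also have "\<dots> < \<infinity>"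
    using nn_integral_bracket_powr_finite[of "2 * x", where 'a='v] nn_integral_bracket_powr_finite[of z, where 'a='z]
      \<open>\<eta> > 0\<close> by (simp add: ennreal_mult_less_top x_def z_def)
  finally show ?thesis .
qed

text \<open>
  By \<open>nn_integral_scaled_kernel_finite\<close> the conversion to \<open>real\<close> loses nothing for \<open>\<theta> > 1 / 2\<close>.
\<close>

definition kernel_mass :: "('v::euclidean_space \<times> 'z::euclidean_space) itself \<Rightarrow> real \<Rightarrow> real" where
  "kernel_mass _ \<theta> = enn2real (\<integral>\<^sup>+n. ennreal (scaled_kernel 0 (n::'v \<times> 'z) powr \<theta>) \<partial>lborel)"

lemma nn_integral_scaled_kernel_eq_mass:
  assumes "\<theta> > 1/2"
  shows "(\<integral>\<^sup>+n. ennreal (scaled_kernel t (n::'v::euclidean_space \<times> 'z::euclidean_space) powr \<theta>) \<partial>lborel)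
    = ennreal (exp (t * Q_dim TYPE('v \<times> 'z)) * kernel_mass TYPE('v \<times> 'z) \<theta>)"
  using nn_integral_scaled_kernel_finite[OF assms, where 'v='v and 'z='z]
  by (subst nn_integral_scaled_kernel) (simp add: kernel_mass_def ennreal_mult less_top)

lemma kernel_mass_1_pos: "0 < kernel_mass TYPE('v::euclidean_space \<times> 'z::euclidean_space) 1"
proof -
  let ?I = "\<integral>\<^sup>+n. ennreal (scaled_kernel 0 (n::'v \<times> 'z) powr 1) \<partial>lborel"
  have "?I \<noteq> 0"
  proof
    assume "?I = 0"
    then have "AE n in lborel. ennreal (scaled_kernel 0 (n::'v \<times> 'z) powr 1) = 0"
      by (subst (asm) nn_integral_0_iff_AE) auto
    then have "AE n in (lborel :: ('v \<times> 'z) measure). False"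
      by eventually_elim (simp add: ennreal_eq_0_iff scaled_kernel_pos[THEN not_le[THEN iffD2]])
    then show False
      using emeasure_lborel_UNIV[where 'a="'v \<times> 'z"] by (simp add: trivial_limit_def[symmetric] ae_filter_eq_bot_iff)
  qed
  then show ?thesis
    using nn_integral_scaled_kernel_finite[of 1, where 'v='v and 'z='z]
    unfolding kernel_mass_def by (simp add: enn2real_positive_iff zero_less_iff_neq_zero)
qed

lemma poisson_const_eq:
  "poisson_const TYPE('v::euclidean_space \<times> 'z::euclidean_space) = 1 / kernel_mass TYPE('v \<times> 'z) 1"
proof -
  let ?Q = "Q_dim TYPE('v \<times> 'z)" and ?c = "kernel_mass TYPE('v \<times> 'z) 1"
  have I: "(\<integral>n. poisson_profile t (n :: 'v \<times> 'z) \<partial>lborel) = ?c" for t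
  proof -
    have "(\<integral>n. poisson_profile t (n :: 'v \<times> 'z) \<partial>lborel) = (\<integral>n. exp (- (t * ?Q)) * scaled_kernel t (n :: 'v \<times> 'z) \<partial>lborel)"
      by (simp add: scaled_kernel_def exp_minus field_simps)
    also have "\<dots> = exp (- (t * ?Q)) * (\<integral>n. scaled_kernel t (n :: 'v \<times> 'z) \<partial>lborel)"
      by simp
    also have "(\<integral>n. scaled_kernel t (n :: 'v \<times> 'z) \<partial>lborel) = exp (t * ?Q) * ?c"
    proof (rule integral_eq_nn_integral[THEN trans])
      show "AE n in lborel. 0 \<le> scaled_kernel t (n :: 'v \<times> 'z)"
        by simp
      show "enn2real (\<integral>\<^sup>+n. ennreal (scaled_kernel t (n :: 'v \<times> 'z)) \<partial>lborel) = exp (t * ?Q) * ?c"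
        using nn_integral_scaled_kernel_eq_mass[of 1 t, where 'v='v and 'z='z]
          kernel_mass_1_pos[where 'v='v and 'z='z] by simp
    qed simp
    finally show ?thesis by (simp add: exp_minus)
  qed
  show ?thesis
    unfolding poisson_const_def
  proof (rule the_equality)
    show "\<forall>t. (\<integral>n. 1 / ?c * poisson_profile t (n :: 'v \<times> 'z) \<partial>lborel) = 1"
      using kernel_mass_1_pos[where 'v='v and 'z='z] by (simp add: I)
    show "C = 1 / ?c" if "\<forall>t. (\<integral>n. C * poisson_profile t (n :: 'v \<times> 'z) \<partial>lborel) = 1" for C
      using that kernel_mass_1_pos[where 'v='v and 'z='z] by (simp add: I field_simps)
  qed
qed

lemma poisson_const_pos: "0 < poisson_const TYPE('v::euclidean_space \<times> 'z::euclidean_space)"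
  by (simp add: poisson_const_eq kernel_mass_1_pos)

lemma poisson_eq_scaled_kernel:
  fixes n :: "'v::euclidean_space \<times> 'z::euclidean_space"
  shows "poisson t n = poisson_const TYPE('v \<times> 'z) * exp (- (t * Q_dim TYPE('v \<times> 'z))) * scaled_kernel t n"
  by (simp add: poisson_def scaled_kernel_def exp_minus)

lemma poisson_pos: "0 < poisson t n"
  by (cases n) (simp add: poisson_eq_scaled_kernel poisson_const_pos scaled_kernel_pos)

lemma nn_integral_poisson:
  "(\<integral>\<^sup>+n. ennreal (poisson t (n::'v::euclidean_space \<times> 'z::euclidean_space)) \<partial>lborel) = 1"
proof -
  have "(\<integral>\<^sup>+n. ennreal (poisson t (n::'v \<times> 'z)) \<partial>lborel)
      = ennreal (poisson_const TYPE('v \<times> 'z) * exp (- (t * Q_dim TYPE('v \<times> 'z)))) *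
        (\<integral>\<^sup>+n. ennreal (scaled_kernel t (n::'v \<times> 'z) powr 1) \<partial>lborel)"
    using poisson_const_pos[where 'v='v and 'z='z]
    by (subst nn_integral_cmult[symmetric])
       (auto simp: poisson_eq_scaled_kernel ennreal_mult[symmetric] less_imp_le intro!: nn_integral_cong)
  also have "\<dots> = 1"
    using kernel_mass_1_pos[where 'v='v and 'z='z]
    by (subst nn_integral_scaled_kernel_eq_mass)
       (simp_all add: poisson_const_eq ennreal_mult[symmetric] exp_minus field_simps)
  finally show ?thesis .
qed

section \<open>A pointwise substitute for interpolation\<close>

text \<open>
  A crude form of the weighted inequality between geometric and arithmetic means: every factor is at
  most the corresponding power of the sum, and the exponents add up to 1.
\<close>

lemma geometric_mean3_le_sum:
  fixes x y z :: real
  assumes nn: "0 \<le> x" "0 \<le> y" "0 \<le> z" and w: "0 \<le> \<alpha>" "0 \<le> \<beta>" "0 \<le> \<gamma>" "\<alpha> + \<beta> + \<gamma> = 1"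
  shows "x powr \<alpha> * y powr \<beta> * z powr \<gamma> \<le> x + y + z"
proof -
  let ?M = "x + y + z"
  have "x powr \<alpha> * y powr \<beta> * z powr \<gamma> \<le> ?M powr \<alpha> * ?M powr \<beta> * ?M powr \<gamma>"
    using nn w by (intro mult_mono powr_mono2) auto
  also have "\<dots> = ?M powr (\<alpha> + \<beta> + \<gamma>)" by (simp add: powr_add)
  also have "\<dots> = ?M" using nn w by simp
  finally show ?thesis .
qed

text \<open>
  In the variable \<open>s = ln v\<close> this is \<open>exp (- \<kappa> \<bar>s\<bar>)\<close>. It is bounded by 1, and integrable with respect to
  the scale-invariant measure \<open>dv / v\<close>: it restores the summability over all scales that a
  scale-invariant estimate would lack.
\<close>

definition tent :: "real \<Rightarrow> real \<Rightarrow> real" where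
  "tent \<kappa> v = min (v powr \<kappa>) (v powr (- \<kappa>))"

lemma tent_nonneg [simp]: "0 \<le> tent \<kappa> v"
  by (simp add: tent_def)

lemma tent_le_1:
  assumes "0 \<le> \<kappa>" "0 \<le> v"
  shows "tent \<kappa> v \<le> 1"
proof (cases "v \<le> 1")
  case True
  then have "v powr \<kappa> \<le> 1" using assms by (intro powr_le1) auto
  then show ?thesis by (simp add: tent_def)
next
  case False
  then have "v powr (- \<kappa>) \<le> v powr 0" using assms by (intro powr_mono) auto
  then show ?thesis using False by (simp add: tent_def)
qed

lemma tent_exp:
  assumes "0 \<le> \<kappa>"
  shows "tent \<kappa> (exp s) = exp (- \<kappa> * \<bar>s\<bar>)"
proof (cases "0 \<le> s")
  case True
  then show ?thesis using assms mult_nonneg_nonneg[of \<kappa> s] by (auto simp: tent_def powr_def min_def mult_le_0_iff)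
next
  case False
  then show ?thesis using assms mult_nonneg_nonpos[of \<kappa> s] by (auto simp: tent_def powr_def min_def mult_le_0_iff)
qed

lemma tent_measurable [measurable]:
  assumes [measurable]: "f \<in> borel_measurable M"
  shows "(\<lambda>x. tent \<kappa> (f x)) \<in> borel_measurable M"
  unfolding tent_def by measurable

text \<open>
  With \<open>\<kappa> = 0\<close> the conditions read \<open>a \<le> b \<le> 1\<close> and \<open>\<theta> (1 - b + a) \<le> 1 - b\<close>, and the last one
  leaves room for \<open>\<theta> > 1 / 2\<close> exactly when \<open>a + b < 1\<close>. Since \<open>a < b\<close>, \<open>b < 1\<close> and \<open>a + b < 1\<close> are
  strict, everything persists for small \<open>\<kappa> > 0\<close>. In the application \<open>a = 1 - 1 / p\<close> and
  \<open>b = 1 - 1 / q\<close>, so the assumptions say \<open>1 < p < q < p / (p - 1)\<close>.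
\<close>

lemma interpolation_parameters:
  fixes a b :: real
  assumes "0 < a" "a < b" "a + b < 1"
  obtains \<kappa> \<theta> where "0 < \<kappa>" "\<kappa> < 1" "1/2 < \<theta>" "a \<le> b / (1 + \<kappa>)" "b / (1 - \<kappa>) \<le> 1"
    "\<theta> * (1 - b / (1 + \<kappa>) + a) \<le> 1 - b"
proof -
  \<comment> \<open>\<open>u\<close> is a lower bound for \<open>b / (1 + \<kappa>)\<close>: the constraint \<open>2 b + a - 1 < u\<close> ensures \<open>\<theta> > 1 / 2\<close>.\<close>
  define u where "u = (max a (2 * b + a - 1) + b) / 2"
  have u: "a < u" "2 * b + a - 1 < u" "u < b" using assms by (auto simp: u_def)
  define \<kappa> where "\<kappa> = min (b / u - 1) (1 - b)"
  define w where "w = b / (1 + \<kappa>)"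
  define \<theta> where "\<theta> = (1 - b) / (1 - w + a)"
  have \<kappa>: "0 < \<kappa>" "\<kappa> < 1" using assms u by (auto simp: \<kappa>_def field_simps)
  have "1 + \<kappa> \<le> b / u" by (simp add: \<kappa>_def)
  then have "(1 + \<kappa>) * u \<le> b" using assms u by (simp add: field_simps)
  then have w: "u \<le> w" using \<kappa> by (simp add: w_def field_simps)
  have "w < b" using \<kappa> assms by (simp add: w_def field_simps)
  then have pos: "0 < 1 - w + a" using assms by simp
  have "1/2 < \<theta>" using pos u w by (simp add: \<theta>_def field_simps)
  moreover have "b / (1 - \<kappa>) \<le> 1" using \<kappa> by (simp add: field_simps \<kappa>_def)
  moreover have "\<theta> * (1 - w + a) \<le> 1 - b" using pos by (simp add: \<theta>_def)
  ultimately show thesis using \<kappa> w u that[of \<kappa> \<theta>] by (simp add: w_def)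
qed

text \<open>
  The heart of the proof. Each term on the right lacks one of the three factors on the left, so that in
  the bilinear form each of them can be integrated by Tonelli's theorem. The bound is a weighted
  geometric mean of the three terms, with weights \<open>1 - w\<close>, \<open>w - a\<close> and \<open>a\<close>. Such a mean always contains
  the product \<open>F powr (1 - a)\<close>; the parameter \<open>w\<close> is free, and the factor \<open>tent \<kappa> v\<close> is harmless because
  \<open>w\<close> may be chosen slightly below \<open>b\<close> for \<open>v \<le> 1\<close> and slightly above \<open>b\<close> for \<open>v > 1\<close>: in both cases
  \<open>(v tent \<kappa> v) powr w = v powr b\<close>.

  This is Young's convolution inequality for two exponents on either side of the wanted one, followed by
  real interpolation between them, carried out pointwise.
\<close>

lemma interpolation_inequality:
  fixes F v D :: real
  assumes F: "0 \<le> F" and v: "0 \<le> v" and D: "0 < D" "D \<le> 1"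
    and a: "0 \<le> a" and b: "0 < b" and \<kappa>: "0 < \<kappa>" "\<kappa> < 1"
    and u: "a \<le> b / (1 + \<kappa>)" "b / (1 - \<kappa>) \<le> 1" and \<theta>: "0 \<le> \<theta>" "\<theta> * (1 - b / (1 + \<kappa>) + a) \<le> 1 - b"
  shows "F powr (1 - a) * v powr b * D powr (1 - b)
     \<le> F * D powr \<theta> + F * (v * tent \<kappa> v) + v * tent \<kappa> v * D powr \<theta>"
proof (cases "v = 0")
  case True
  then show ?thesis using F D b by (simp add: tent_def)
next
  case False
  then have v0: "0 < v" using v by simp
  define w where "w = (if v \<le> 1 then b / (1 + \<kappa>) else b / (1 - \<kappa>))"
  have "b / (1 + \<kappa>) \<le> b / (1 - \<kappa>)" using b \<kappa> by (intro divide_left_mono) auto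
  then have w: "b / (1 + \<kappa>) \<le> w" "w \<le> 1" "a \<le> w" using u by (auto simp: w_def)
  let ?m = "v * tent \<kappa> v"
  have m: "?m powr w = v powr b"
  proof (cases "v \<le> 1")
    case True
    have "v powr \<kappa> \<le> v powr (- \<kappa>)" using True v0 \<kappa> by (intro powr_mono') auto
    then have "?m = v powr (1 + \<kappa>)" using v0 by (simp add: tent_def powr_add)
    then show ?thesis using True \<kappa> by (simp add: powr_powr w_def)
  next
    case False
    have "v powr (- \<kappa>) \<le> v powr \<kappa>" using False \<kappa> by (intro powr_mono) auto
    then have "?m = v powr (1 - \<kappa>)" using v0 by (simp add: tent_def powr_diff powr_minus field_simps)
    then show ?thesis using False \<kappa> by (simp add: powr_powr w_def)
  qed
  \<comment> \<open>As \<open>D \<le> 1\<close>, an exponent of \<open>D\<close> that is too small only enlarges the bound.\<close>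
  have e: "\<theta> * (1 - w + a) \<le> 1 - b"
    using mult_left_mono[OF _ \<theta>(1), of "1 - w + a" "1 - b / (1 + \<kappa>) + a"] w \<theta> by simp
  have "F powr (1 - a) * v powr b * D powr (1 - b) \<le> F powr (1 - a) * ?m powr w * D powr (\<theta> * (1 - w + a))"
    unfolding m using D e by (intro mult_left_mono powr_mono') auto
  also have "\<dots> = (F * D powr \<theta>) powr (1 - w) * (F * ?m) powr (w - a) * (?m * D powr \<theta>) powr a"
  proof -
    have "F powr (1 - a) = F powr (1 - w) * F powr (w - a)" "?m powr w = ?m powr (w - a) * ?m powr a"
      by (simp_all add: powr_add[symmetric])
    moreover have "D powr (\<theta> * (1 - w + a)) = D powr (\<theta> * (1 - w)) * D powr (\<theta> * a)"
      by (simp add: powr_add[symmetric] algebra_simps)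
    ultimately show ?thesis
      using F v0 D by (simp add: powr_mult powr_powr mult_ac)
  qed
  also have "\<dots> \<le> F * D powr \<theta> + F * ?m + ?m * D powr \<theta>"
    using F v0 D w a by (intro geometric_mean3_le_sum) auto
  finally show ?thesis .
qed

definition tent_mass :: "real \<Rightarrow> real" where
  "tent_mass c = enn2real (\<integral>\<^sup>+t. ennreal (exp (- c * \<bar>t\<bar>)) \<partial>lborel)"

text \<open>
  The substitution \<open>t \<mapsto> t + ln H / Q\<close> shows that the integral of the tent does not depend on \<open>H\<close>. The
  factor \<open>H\<close> in front covers the case \<open>H = 0\<close>.
\<close>

lemma nn_integral_tent:
  assumes "0 < \<kappa>" "0 < Q" "0 \<le> H"
  shows "(\<integral>\<^sup>+t. ennreal (H * tent \<kappa> (exp (t * Q) * H)) \<partial>lborel) = ennreal (H * tent_mass (\<kappa> * Q))"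
proof (cases "H = 0")
  case True
  then show ?thesis by simp
next
  case False
  then have H: "0 < H" using assms by simp
  have "tent \<kappa> (exp (t * Q) * H) = exp (- (\<kappa> * Q) * \<bar>ln H / Q + 1 * t\<bar>)" for t
  proof -
    have "exp (t * Q) * H = exp (t * Q + ln H)" using H by (simp add: exp_add)
    moreover have "\<bar>t * Q + ln H\<bar> = Q * \<bar>ln H / Q + 1 * t\<bar>"
      using assms by (simp add: abs_mult_pos' field_simps flip: abs_mult_pos)
    ultimately show ?thesis using assms by (simp add: tent_exp)
  qed
  then have "(\<integral>\<^sup>+t. ennreal (H * tent \<kappa> (exp (t * Q) * H)) \<partial>lborel)
      = ennreal H * (\<integral>\<^sup>+t. ennreal (exp (- (\<kappa> * Q) * \<bar>ln H / Q + 1 * t\<bar>)) \<partial>lborel)"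
    using H by (subst nn_integral_cmult[symmetric]) (auto simp: ennreal_mult)
  also have "(\<integral>\<^sup>+t. ennreal (exp (- (\<kappa> * Q) * \<bar>ln H / Q + 1 * t\<bar>)) \<partial>lborel)
      = (\<integral>\<^sup>+t. ennreal (exp (- (\<kappa> * Q) * \<bar>t\<bar>)) \<partial>lborel)"
    using nn_integral_real_affine[of "\<lambda>t. ennreal (exp (- (\<kappa> * Q) * \<bar>t\<bar>))" 1 "ln H / Q"] by simp
  also have "\<dots> = ennreal (tent_mass (\<kappa> * Q))"
    using nn_integral_exp_minus_abs_finite[of "\<kappa> * Q"] assms by (simp add: tent_mass_def less_top)
  finally show ?thesis using H by (simp add: ennreal_mult tent_mass_def)
qed

section \<open>Weak norms and duality\<close>

text \<open>
  Chebyshev's inequality for the weak norm: if the superlevel set had measure above \<open>t > (W / s) powr p\<close>,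
  the rearrangement at \<open>t\<close> would be at least \<open>s\<close>, and \<open>t powr (1 / p) * s\<close> would exceed \<open>W\<close>.
\<close>

lemma emeasure_superlevel_le_weak_norm:
  assumes [measurable]: "f \<in> borel_measurable M"
    and W: "weak_norm M p f \<le> ennreal W" and "0 \<le> W" "0 < p" "0 < s"
  shows "emeasure M {x \<in> space M. s < norm (f x)} \<le> ennreal ((W / s) powr p)"
proof (rule ccontr)
  let ?mu = "\<lambda>s. emeasure M {x \<in> space M. s < ennreal (norm (f x))}"
  have mu: "?mu (ennreal s) = emeasure M {x \<in> space M. s < norm (f x)}"
    using \<open>0 < s\<close> by (simp add: ennreal_less_iff)
  assume "\<not> ?thesis"
  then have "ennreal ((W / s) powr p) < ?mu (ennreal s)" by (simp add: mu not_le)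
  then obtain t' where t': "ennreal ((W / s) powr p) < t'" "t' < ?mu (ennreal s)" using dense by blast
  have "t' < top" using t'(2) top_greatest by (rule less_le_trans)
  then obtain t where tt: "t' = ennreal t" "0 \<le> t" by (cases t') auto
  have t: "(W / s) powr p < t" "ennreal t < ?mu (ennreal s)"
    using t' tt by (simp_all add: ennreal_less_iff)
  have t0: "0 < t" using t(1) powr_ge_zero[of "W / s" p] by linarith
  have "ennreal s \<le> rearrangement M f t"
    unfolding rearrangement_def
  proof (rule Inf_greatest, clarify)
    fix r assume r: "?mu r \<le> ennreal t"
    show "ennreal s \<le> r"
    proof (rule ccontr)
      assume "\<not> ennreal s \<le> r"
      then have "?mu (ennreal s) \<le> ?mu r"
        by (intro emeasure_mono) auto
      then show False using r t(2) by simp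
    qed
  qed
  then have "ennreal (t powr (1 / p)) * ennreal s \<le> ennreal (t powr (1 / p)) * rearrangement M f t"
    by (intro mult_left_mono) auto
  also have "\<dots> \<le> weak_norm M p f"
    unfolding weak_norm_def using t0 by (intro SUP_upper) auto
  also have "\<dots> \<le> ennreal W" by (rule W)
  finally have "t powr (1 / p) * s \<le> W"
    using assms by (simp add: ennreal_mult[symmetric])
  then have "t powr (1 / p) \<le> W / s" using \<open>0 < s\<close> by (simp add: field_simps)
  then have "(t powr (1 / p)) powr p \<le> (W / s) powr p" using \<open>0 < p\<close> by (intro powr_mono2) auto
  then show False using t t0 \<open>0 < p\<close> by (simp add: powr_powr)
qed

text \<open>
  Dyadic decomposition: if \<open>u\<close> is bounded by \<open>c j\<close> on pieces \<open>A j\<close> of measure at most \<open>d j\<close>, and the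
  products \<open>c j * d j\<close> decay geometrically, the sum of the pieces bounds the integral.
\<close>

lemma nn_integral_le_geometric:
  fixes u :: "'a \<Rightarrow> real" and c d :: "nat \<Rightarrow> real"
  assumes [measurable]: "\<And>j. A j \<in> sets M" and A: "\<And>j. emeasure M (A j) \<le> ennreal (d j)"
    and c: "\<And>j. 0 \<le> c j" and d: "\<And>j. 0 \<le> d j" and cd: "\<And>j. c j * d j = K * r ^ j" and r: "0 \<le> r" "r < 1" "0 \<le> K"
    and u: "\<And>x. x \<in> space M \<Longrightarrow> u x \<le> 0 \<or> (\<exists>j::nat. x \<in> A j \<and> u x \<le> c j)"
  shows "(\<integral>\<^sup>+x. ennreal (u x) \<partial>M) \<le> ennreal (K / (1 - r))"
proof -
  have "(\<integral>\<^sup>+x. ennreal (u x) \<partial>M) \<le> (\<integral>\<^sup>+x. (\<Sum>j. ennreal (c j) * indicator (A j) x) \<partial>M)"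
  proof (rule nn_integral_mono)
    fix x assume "x \<in> space M"
    from u[OF this] show "ennreal (u x) \<le> (\<Sum>j. ennreal (c j) * indicator (A j) x)"
    proof
      assume "\<exists>j. x \<in> A j \<and> u x \<le> c j"
      then obtain j where j: "x \<in> A j" "u x \<le> c j" by blast
      then have "ennreal (u x) \<le> ennreal (c j) * indicator (A j) x" by (simp add: ennreal_leI)
      also have "\<dots> \<le> (\<Sum>j. ennreal (c j) * indicator (A j) x)"
      proof -
        define f where "f = (\<lambda>j. ennreal (c j) * indicator (A j) x :: ennreal)"
        have "f j \<le> suminf f" using sum_le_suminf[of f "{j}"] by simp
        then show ?thesis unfolding f_def .
      qed
      finally show ?thesis .
    qed (simp add: ennreal_neg)
  qed
  also have "\<dots> = (\<Sum>j. ennreal (c j) * emeasure M (A j))"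
    by (simp add: nn_integral_suminf nn_integral_cmult_indicator)
  also have "\<dots> \<le> (\<Sum>j. ennreal (K * r ^ j))"
  proof (intro suminf_le summableI)
    fix j
    have "ennreal (c j) * emeasure M (A j) \<le> ennreal (c j) * ennreal (d j)"
      by (intro mult_left_mono A) simp
    then show "ennreal (c j) * emeasure M (A j) \<le> ennreal (K * r ^ j)"
      using c d by (simp add: ennreal_mult[symmetric] cd)
  qed
  also have "\<dots> = ennreal (K / (1 - r))"
  proof -
    have "(\<lambda>j. K * r ^ j) sums (K * (1 / (1 - r)))"
      using r by (intro sums_mult geometric_sums) simp
    then show ?thesis
      using r by (intro suminf_ennreal_eq) auto
  qed
  finally show ?thesis .
qed

text \<open>
  Above height 1 a function of weak type \<open>p > 1\<close> is integrable, and below height 1 its powers of every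
  exponent \<open>r > p\<close> are integrable: on the layer of height \<open>2 ^ j\<close> the integrands have size \<open>2 ^ j\<close> and
  \<open>2 ^ (j r)\<close>, against the measure \<open>2 ^ (- j p)\<close>, with \<open>j \<ge> 0\<close> above and \<open>j \<le> 0\<close> below.
\<close>

lemma nn_integral_large_values_le:
  fixes g :: "'a \<Rightarrow> real"
  assumes [measurable]: "g \<in> borel_measurable M" and "1 < p"
    and mu: "\<And>s. 0 < s \<Longrightarrow> emeasure M {x \<in> space M. s < g x} \<le> ennreal (s powr (- p))"
  shows "(\<integral>\<^sup>+x. ennreal (if 1 < g x then g x else 0) \<partial>M) \<le> ennreal (2 / (1 - 2 powr (1 - p)))"
proof (rule nn_integral_le_geometric)
  show "{x \<in> space M. 2 ^ j < g x} \<in> sets M" for j :: nat by measurable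
  show "emeasure M {x \<in> space M. 2 ^ j < g x} \<le> ennreal ((2 ^ j) powr (- p))" for j :: nat
    by (rule mu) simp
  show "2 ^ (j + 1) * (2 ^ j) powr (- p) = 2 * (2 powr (1 - p)) ^ j" for j :: nat
    by (simp add: powr_realpow[symmetric] powr_powr powr_add[symmetric] powr_diff powr_minus field_simps)
  show "(2::real) powr (1 - p) < 1" using \<open>1 < p\<close> powr_less_mono[of "1 - p" 0 2] by simp
  show "(if 1 < g x then g x else 0) \<le> 0 \<or> (\<exists>j::nat. x \<in> {x \<in> space M. 2 ^ j < g x} \<and> (if 1 < g x then g x else 0) \<le> 2 ^ (j + 1))"
    if "x \<in> space M" for x
  proof (cases "1 < g x")
    case True
    obtain n where "g x \<le> 2 ^ n" using real_arch_pow[of 2 "g x"] by (auto intro: less_imp_le)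
    from ex_least_nat_less[of "\<lambda>n. g x \<le> 2 ^ n", OF this] obtain k where "\<not> g x \<le> 2 ^ k" "g x \<le> 2 ^ (k + 1)"
      using True by auto
    then show ?thesis using that by (intro disjI2 exI[of _ k]) auto
  qed simp
qed simp_all

lemma nn_integral_small_values_le:
  fixes g :: "'a \<Rightarrow> real"
  assumes [measurable]: "g \<in> borel_measurable M" and nn: "\<And>x. 0 \<le> g x" and "0 < p" "p < r"
    and mu: "\<And>s. 0 < s \<Longrightarrow> emeasure M {x \<in> space M. s < g x} \<le> ennreal (s powr (- p))"
  shows "(\<integral>\<^sup>+x. ennreal ((if g x \<le> 1 then g x else 0) powr r) \<partial>M) \<le> ennreal (2 powr p / (1 - 2 powr (p - r)))"
proof (rule nn_integral_le_geometric)
  show "{x \<in> space M. (1/2) ^ (j + 1) < g x} \<in> sets M" for j :: nat by measurable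
  show "emeasure M {x \<in> space M. (1/2) ^ (j + 1) < g x} \<le> ennreal (((1/2) ^ (j + 1)) powr (- p))" for j :: nat
    by (rule mu) simp
  have half: "((1/2) ^ n) powr a = 2 powr (- (real n * a))" for n and a :: real
  proof -
    have "((1/2::real) ^ n) = 2 powr (- real n)"
      by (simp only: powr_minus powr_realpow[OF zero_less_numeral] power_one_over inverse_eq_divide)
    then show ?thesis by (simp add: powr_powr)
  qed
  show "((1/2) ^ j) powr r * ((1/2) ^ (j + 1)) powr (- p) = 2 powr p * (2 powr (p - r)) ^ j" for j :: nat
    unfolding half by (simp add: powr_realpow[symmetric] powr_powr powr_add[symmetric] algebra_simps)
  show "(2::real) powr (p - r) < 1" using \<open>p < r\<close> powr_less_mono[of "p - r" 0 2] by simp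
  show "(if g x \<le> 1 then g x else 0) powr r \<le> 0 \<or> (\<exists>j::nat. x \<in> {x \<in> space M. (1/2) ^ (j + 1) < g x} \<and> (if g x \<le> 1 then g x else 0) powr r \<le> ((1/2) ^ j) powr r)"
    if "x \<in> space M" for x
  proof (cases "0 < g x \<and> g x \<le> 1")
    case True
    obtain n where "(1/2) ^ n < g x" using real_arch_pow_inv[of "g x" "1/2"] True by auto
    from ex_least_nat_less[of "\<lambda>n. (1/2) ^ n < g x", OF this] obtain k where "\<not> (1/2) ^ k < g x" "(1/2) ^ (k + 1) < g x"
      using True by auto
    then show ?thesis using that True \<open>0 < p\<close> \<open>p < r\<close> by (intro disjI2 exI[of _ k]) (auto intro!: powr_mono2)
  next
    case False
    then have "g x = 0 \<or> \<not> g x \<le> 1" using nn[of x] by auto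
    then show ?thesis by auto
  qed
qed simp_all

text \<open>
  The converse of Hoelder's inequality, testing with multiples of \<open>F powr (q - 1)\<close>. As the integral of
  \<open>F powr q\<close> is not known to be finite in advance, the test function is built from the truncations
  \<open>g k\<close> of \<open>F\<close> at height \<open>k\<close> and to the ball of radius \<open>k\<close>.
\<close>

lemma nn_integral_powr_le_by_duality:
  fixes F :: "'a::euclidean_space \<Rightarrow> ennreal"
  assumes [measurable]: "F \<in> borel_measurable borel" and q: "1 < q" and C: "0 \<le> C"
    and dual: "\<And>h :: 'a \<Rightarrow> real. h \<in> borel_measurable borel \<Longrightarrow> (\<And>n. 0 \<le> h n) \<Longrightarrow>
      (\<integral>\<^sup>+n. ennreal (h n powr (q / (q - 1))) \<partial>lborel) \<le> 1 \<Longrightarrow> (\<integral>\<^sup>+n. F n * ennreal (h n) \<partial>lborel) \<le> ennreal C"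
  shows "AE n in lborel. F n < \<infinity>"
    and "(\<integral>\<^sup>+n. ennreal (enn2real (F n) powr q) \<partial>lborel) \<le> ennreal (C powr q)"
proof -
  define g where "g k n = enn2real (min (F n) (of_nat k)) * indicator (ball 0 (real k)) n" for k :: nat and n
  have [measurable]: "ball (0::'a) (real k) \<in> sets borel" for k by simp
  have [measurable]: "g k \<in> borel_measurable borel" for k unfolding g_def by measurable
  have g0: "0 \<le> g k n" for k n by (simp add: g_def)
  have fin: "min (F n) (of_nat k) < top" for n k by (simp add: min_less_iff_disj ennreal_of_nat_eq_real_of_nat)
  have gF: "ennreal (g k n) \<le> F n" for k n
    using fin[of n k] by (auto simp: g_def indicator_def)
  have gmono: "g k n \<le> g l n" if "k \<le> l" for k l n
  proof -
    have "enn2real (min (F n) (of_nat k)) \<le> enn2real (min (F n) (of_nat l))"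
      using that fin[of n l] by (intro enn2real_mono min.mono) auto
    then show ?thesis using that by (auto simp: g_def indicator_def)
  qed
  have bound: "(\<integral>\<^sup>+n. ennreal (g k n powr q) \<partial>lborel) \<le> ennreal (C powr q)" for k
  proof -
    define a where "a = (\<integral>\<^sup>+n. ennreal (g k n powr q) \<partial>lborel)"
    have "g k n powr q \<le> real k powr q * indicator (ball 0 (real k)) n" for n
    proof (cases "n \<in> ball 0 (real k)")
      case True
      have "enn2real (min (F n) (of_nat k)) \<le> enn2real (ennreal (real k))"
        by (intro enn2real_mono) (auto simp: ennreal_of_nat_eq_real_of_nat)
      then have "g k n \<le> real k" using True by (simp add: g_def)
      then show ?thesis using True g0 q by (simp add: powr_mono2)
    qed (simp add: g_def)
    from ennreal_leI[OF this]
    have "ennreal (g k n powr q) \<le> ennreal (real k powr q) * indicator (ball 0 (real k)) n" for n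
      by (simp add: ennreal_mult ennreal_indicator)
    then have "a \<le> (\<integral>\<^sup>+n. ennreal (real k powr q) * indicator (ball (0::'a) (real k)) n \<partial>lborel)"
      unfolding a_def by (intro nn_integral_mono) simp
    also have "\<dots> < \<infinity>"
      using emeasure_lborel_ball_finite[of "0::'a" "real k"] by (simp add: nn_integral_cmult_indicator ennreal_mult_less_top)
    finally obtain A where A: "a = ennreal A" "0 \<le> A" by (cases a) auto
    show ?thesis
    proof (cases "A = 0")
      case True
      then show ?thesis using A by (simp add: a_def)
    next
      case False
      then have A0: "0 < A" using A by simp
      define h where "h n = g k n powr (q - 1) * A powr (- ((q - 1) / q))" for n
      have "h n powr (q / (q - 1)) = g k n powr q * (1 / A)" for n
      proof -
        have e: "(q - 1) * (q / (q - 1)) = q" "- ((q - 1) / q) * (q / (q - 1)) = - 1"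
          using q by (simp_all add: field_simps)
        have "h n powr (q / (q - 1)) = (g k n powr (q - 1)) powr (q / (q - 1)) * (A powr (- ((q - 1) / q))) powr (q / (q - 1))"
          unfolding h_def by (rule powr_mult)
        also have "\<dots> = g k n powr q * A powr (- 1)"
          by (simp only: powr_powr e)
        finally show ?thesis using A0 by (simp add: powr_minus divide_inverse)
      qed
      then have "(\<integral>\<^sup>+n. ennreal (h n powr (q / (q - 1))) \<partial>lborel) = a * ennreal (1 / A)"
        unfolding a_def using A0 by (subst nn_integral_multc[symmetric]) (auto simp: ennreal_mult[symmetric])
      also have "\<dots> = 1" using A A0 by (simp add: ennreal_mult[symmetric])
      finally have "(\<integral>\<^sup>+n. F n * ennreal (h n) \<partial>lborel) \<le> ennreal C"
        by (intro dual) (auto simp: h_def)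
      moreover have "a * ennreal (A powr (- ((q - 1) / q))) \<le> (\<integral>\<^sup>+n. F n * ennreal (h n) \<partial>lborel)"
        unfolding a_def
      proof (subst nn_integral_multc[symmetric], simp, rule nn_integral_mono)
        fix n
        have "g k n powr q = g k n * g k n powr (q - 1)"
          using g0[of k n] by (cases "g k n = 0") (simp_all add: powr_diff)
        then have "ennreal (g k n powr q) * ennreal (A powr (- ((q - 1) / q))) = ennreal (g k n) * ennreal (h n)"
          using g0[of k n] by (simp add: h_def ennreal_mult[symmetric] mult.assoc)
        also have "\<dots> \<le> F n * ennreal (h n)" by (intro mult_right_mono gF) simp
        finally show "ennreal (g k n powr q) * ennreal (A powr (- ((q - 1) / q))) \<le> F n * ennreal (h n)" .
      qed
      ultimately have "ennreal (A * A powr (- ((q - 1) / q))) \<le> ennreal C"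
        using A by (simp add: ennreal_mult)
      then have "A * A powr (- ((q - 1) / q)) \<le> C" using C by simp
      moreover have "A * A powr (- ((q - 1) / q)) = A powr (1 / q)"
        using powr_add[of A 1 "- ((q - 1) / q)"] A0 q by (simp add: field_simps)
      ultimately have "(A powr (1 / q)) powr q \<le> C powr q" using q by (intro powr_mono2) auto
      then show ?thesis using A A0 q by (simp add: a_def powr_powr ennreal_leI)
    qed
  qed
  define G where "G n = (SUP k. ennreal (g k n powr q))" for n
  have "(\<integral>\<^sup>+n. G n \<partial>lborel) = (SUP k. \<integral>\<^sup>+n. ennreal (g k n powr q) \<partial>lborel)"
    unfolding G_def using q
    by (intro nn_integral_monotone_convergence_SUP) (auto simp: incseq_def le_fun_def intro!: ennreal_leI powr_mono2 g0 gmono)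
  also have "\<dots> \<le> ennreal (C powr q)" by (intro SUP_least bound)
  finally have G: "(\<integral>\<^sup>+n. G n \<partial>lborel) \<le> ennreal (C powr q)" .
  have [measurable]: "G \<in> borel_measurable borel" unfolding G_def by measurable
  have Gge: "ennreal (enn2real (F n) powr q) \<le> G n" if fin: "F n < \<infinity>" for n
  proof -
    obtain r where r: "F n = ennreal r" "0 \<le> r" using fin by (cases "F n") auto
    obtain k :: nat where k: "max r (norm n) < real k" using reals_Archimedean2 by blast
    then have "min (F n) (of_nat k) = F n"
      by (simp add: r ennreal_of_nat_eq_real_of_nat min_def ennreal_leI)
    then have "g k n = enn2real (F n)" using k by (simp add: g_def)
    then show ?thesis unfolding G_def by (metis SUP_upper UNIV_I)
  qed
  \<comment> \<open>Where \<open>F\<close> is infinite the conversion to \<open>real\<close> gives 0, but \<open>g k\<close> still grows like \<open>k\<close>.\<close>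
  have Gtop: "G n = \<infinity>" if "\<not> F n < \<infinity>" for n
  proof -
    have "ennreal (real m) \<le> G n" for m :: nat
    proof -
      obtain k :: nat where k: "max (real m + 1) (norm n) < real k" using reals_Archimedean2 by blast
      have "F n = top" using that by (metis infinity_ennreal_def top.not_eq_extremum)
      then have gk: "g k n = real k" using k by (simp add: g_def min_def top_unique ennreal_of_nat_eq_real_of_nat)
      have "real m \<le> real k powr 1" using k by simp
      also have "\<dots> \<le> real k powr q" using k q by (intro powr_mono) auto
      finally have "ennreal (real m) \<le> ennreal (g k n powr q)" by (simp add: gk ennreal_leI)
      also have "\<dots> \<le> G n" unfolding G_def by (rule SUP_upper) simp
      finally show ?thesis .
    qed
    then have "of_nat m \<le> G n" for m by (simp add: ennreal_of_nat_eq_real_of_nat)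
    then show ?thesis using ennreal_Ex_less_of_nat[of "G n"] by (metis infinity_ennreal_def leD top.not_eq_extremum)
  qed
  have "AE n in lborel. G n \<noteq> \<infinity>"
    using G by (intro nn_integral_PInf_AE) (auto simp: top_unique)
  then show "AE n in lborel. F n < \<infinity>" by eventually_elim (use Gtop in blast)
  have "(\<integral>\<^sup>+n. ennreal (enn2real (F n) powr q) \<partial>lborel) \<le> (\<integral>\<^sup>+n. G n \<partial>lborel)"
  proof (rule nn_integral_mono)
    show "ennreal (enn2real (F n) powr q) \<le> G n" for n
      using Gge[of n] Gtop[of n] by (cases "F n < \<infinity>") auto
  qed
  then show "(\<integral>\<^sup>+n. ennreal (enn2real (F n) powr q) \<partial>lborel) \<le> ennreal (C powr q)"
    using G by (rule order_trans)
qed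

section \<open>The bilinear form of the Fourier transform\<close>

lemma nn_integral_lborel_swap:
  fixes g :: "'a::euclidean_space \<Rightarrow> 'b::euclidean_space \<Rightarrow> ennreal"
  assumes "(\<lambda>z. g (fst z) (snd z)) \<in> borel_measurable borel"
  shows "(\<integral>\<^sup>+x. (\<integral>\<^sup>+y. g x y \<partial>lborel) \<partial>lborel) = (\<integral>\<^sup>+y. (\<integral>\<^sup>+x. g x y \<partial>lborel) \<partial>lborel)"
  using lborel_pair.Fubini[OF lborel_pair_measurable[OF assms]] by simp

lemma sets_haar_S: "sets (haar_S :: ('v::euclidean_space, 'z::euclidean_space) DR measure) = sets borel"
  by (simp add: haar_S_def)

lemma borel_measurable_haar_S:
  "f \<in> borel_measurable (haar_S :: ('v::euclidean_space, 'z::euclidean_space) DR measure) \<longleftrightarrow> f \<in> borel_measurable borel"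
  using measurable_cong_sets[OF sets_haar_S refl] by auto

lemma haar_density:
  "(\<lambda>(n, t). ennreal (exp (- 2 * rho TYPE('v::euclidean_space \<times> 'z::euclidean_space) * t)))
     = (\<lambda>x::('v,'z) DR. ennreal (exp (- (Q_dim TYPE('v \<times> 'z) * snd x))))"
  by (auto simp: rho_def)

lemma nn_integral_haar_S:
  fixes g :: "('v::euclidean_space, 'z::euclidean_space) DR \<Rightarrow> ennreal"
  assumes [measurable]: "g \<in> borel_measurable borel"
  shows "(\<integral>\<^sup>+x. g x \<partial>haar_S) = (\<integral>\<^sup>+x. ennreal (exp (- (Q_dim TYPE('v \<times> 'z) * snd x))) * g x \<partial>lborel)"
  unfolding haar_S_def haar_density by (subst nn_integral_density) auto

lemma poisson_S_eq: "poisson_S br x n = poisson (snd x) (N_mult br (- n) (fst x))"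
  by (simp add: poisson_S_def case_prod_beta)

lemma poisson_S_pos [simp]: "0 < poisson_S br x n"
  by (simp add: poisson_S_eq poisson_pos)

lemma poisson_S_nonneg [simp]: "0 \<le> poisson_S br x n"
  by (rule less_imp_le) simp

lemma measurable_poisson_S:
  fixes f :: "'a \<Rightarrow> ('v::euclidean_space, 'z::euclidean_space) DR"
  assumes H: "H_type br" and [measurable]: "f \<in> borel_measurable M" "g \<in> borel_measurable M"
  shows "(\<lambda>y. poisson_S br (f y) (g y)) \<in> borel_measurable M"
proof -
  have [measurable]: "(\<lambda>y. N_mult br (- g y) (fst (f y))) \<in> borel_measurable M"
    by (intro measurable_N_mult[OF H]) measurable
  show ?thesis
    unfolding poisson_S_eq poisson_eq_scaled_kernel by measurable
qed

lemma nn_integral_poisson_S: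
  assumes H: "H_type br"
  shows "(\<integral>\<^sup>+n. ennreal (poisson_S br x n) \<partial>lborel) = 1"
proof -
  have "(\<lambda>n. ennreal (poisson (snd x) n)) \<in> borel_measurable borel"
    unfolding poisson_eq_scaled_kernel by measurable
  from nn_integral_N_mult_left[OF H this, of "fst x"] show ?thesis
    by (simp add: poisson_S_eq nn_integral_poisson)
qed

text \<open>
  On the line \<open>\<alpha> + \<i> \<gamma>\<^sub>q \<rho>\<close> the power of the Poisson kernel has modulus \<open>P powr (1 / q)\<close>. Hence this
  function with \<open>e = 1 / q\<close> and \<open>norm \<circ> f\<close> in place of \<open>f\<close> dominates the Fourier transform, and it is
  finite exactly where the defining integral converges.
\<close>

definition fourier_majorant ::
  "('v::euclidean_space \<times> 'z::euclidean_space \<Rightarrow> 'v \<times> 'z \<Rightarrow> 'v \<times> 'z) \<Rightarrow>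
     real \<Rightarrow> (('v, 'z) DR \<Rightarrow> real) \<Rightarrow> 'v \<times> 'z \<Rightarrow> ennreal" where
  "fourier_majorant br e f n = (\<integral>\<^sup>+x. ennreal (f x * poisson_S br x n powr e) \<partial>haar_S)"

lemma fourier_majorant_eq_lborel:
  fixes f :: "('v::euclidean_space, 'z::euclidean_space) DR \<Rightarrow> real"
  assumes H: "H_type br" and [measurable]: "f \<in> borel_measurable borel" and f: "\<And>x. 0 \<le> f x"
  shows "fourier_majorant br e f n
     = (\<integral>\<^sup>+x. ennreal (exp (- (Q_dim TYPE('v \<times> 'z) * snd x)) * f x * poisson_S br x n powr e) \<partial>lborel)"
proof -
  note [measurable] = measurable_poisson_S[OF H]
  show ?thesis
    unfolding fourier_majorant_def using f
    by (subst nn_integral_haar_S) (auto simp: ennreal_mult[symmetric] mult.assoc)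
qed

lemma measurable_fourier_majorant:
  fixes f :: "('v::euclidean_space, 'z::euclidean_space) DR \<Rightarrow> real"
  assumes H: "H_type br" and [measurable]: "f \<in> borel_measurable borel" and f: "\<And>x. 0 \<le> f x"
  shows "fourier_majorant br e f \<in> borel_measurable borel"
proof -
  note [measurable] = measurable_poisson_S[OF H]
  have "(\<lambda>z. ennreal (exp (- (Q_dim TYPE('v \<times> 'z) * snd (snd z))) * f (snd z) * poisson_S br (snd z) (fst z) powr e))
    \<in> borel_measurable borel" by measurable
  moreover have "fourier_majorant br e f = (\<lambda>n. \<integral>\<^sup>+x. ennreal (exp (- (Q_dim TYPE('v \<times> 'z) * snd x)) * f x * poisson_S br x n powr e) \<partial>lborel)"
    by (intro ext fourier_majorant_eq_lborel assms)
  ultimately show ?thesis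
    using borel_measurable_nn_integral_pair by fastforce
qed

text \<open>
  The bilinear form that is estimated from here on. The weight \<open>exp (- Q t)\<close> is the density of the left
  Haar measure.
\<close>

lemma pairing_fourier_majorant:
  fixes f :: "('v::euclidean_space, 'z::euclidean_space) DR \<Rightarrow> real"
  assumes H: "H_type br" and [measurable]: "f \<in> borel_measurable borel" and f: "\<And>x. 0 \<le> f x"
    and [measurable]: "h \<in> borel_measurable borel" and h: "\<And>n. 0 \<le> h n"
  shows "(\<integral>\<^sup>+n. fourier_majorant br e f n * ennreal (h n) \<partial>lborel)
    = (\<integral>\<^sup>+n. (\<integral>\<^sup>+x. ennreal (exp (- (Q_dim TYPE('v \<times> 'z) * snd x)) * f x * poisson_S br x n powr e * h n) \<partial>lborel) \<partial>lborel)"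
proof (rule nn_integral_cong)
  fix n
  note [measurable] = measurable_poisson_S[OF H]
  show "fourier_majorant br e f n * ennreal (h n)
    = (\<integral>\<^sup>+x. ennreal (exp (- (Q_dim TYPE('v \<times> 'z) * snd x)) * f x * poisson_S br x n powr e * h n) \<partial>lborel)"
    unfolding fourier_majorant_eq_lborel[OF assms(1-3)]
    using f h by (subst nn_integral_multc[symmetric]) (auto simp: ennreal_mult)
qed

text \<open>
  Young's inequality gives \<open>P powr (1 / q) * h \<le> P / q + (1 - 1 / q) * h powr (q / (q - 1))\<close>. For fixed
  \<open>x\<close> the right-hand side has integral at most \<open>1 / q + (1 - 1 / q) = 1\<close> over \<open>N\<close>, which is why the constant
  is 1.
\<close>

lemma pairing_L1_bound:
  fixes f :: "('v::euclidean_space, 'z::euclidean_space) DR \<Rightarrow> real"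
  assumes H: "H_type br" and [measurable]: "f \<in> borel_measurable borel" and f: "\<And>x. 0 \<le> f x"
    and K: "(\<integral>\<^sup>+x. ennreal (f x) \<partial>haar_S) \<le> K"
    and q: "1 < q"
    and [measurable]: "h \<in> borel_measurable borel" and h: "\<And>n. 0 \<le> h n"
    and h1: "(\<integral>\<^sup>+n. ennreal (h n powr (q / (q - 1))) \<partial>lborel) \<le> 1"
  shows "(\<integral>\<^sup>+n. fourier_majorant br (1 / q) f n * ennreal (h n) \<partial>lborel) \<le> K"
proof -
  note [measurable] = measurable_poisson_S[OF H]
  let ?Q = "Q_dim TYPE('v \<times> 'z)"
  define r where "r = q / (q - 1)"
  have r: "1 / r = 1 - 1 / q" "0 < r" using q by (auto simp: r_def field_simps)
  define a b where "a = 1 / q" and "b = 1 - 1 / q"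
  have ab: "0 \<le> a" "0 \<le> b" "a + b = 1" using q by (auto simp: a_def b_def)
  let ?Y = "\<lambda>x n. ennreal a * ennreal (poisson_S br x n) + ennreal b * ennreal (h n powr r)"
  have *: "ennreal (exp (- (?Q * snd x)) * f x * poisson_S br x n powr (1 / q) * h n)
     \<le> ennreal (exp (- (?Q * snd x)) * f x) * ?Y x n" for x n
  proof -
    have "poisson_S br x n powr (1 / q) * (h n powr r) powr (1 - 1 / q)
        \<le> (1 / q) * poisson_S br x n + (1 - 1 / q) * h n powr r"
    proof (cases "h n = 0")
      case False
      then show ?thesis using q by (intro Youngs_inequality_0) auto
    qed (use q in simp)
    moreover have "(h n powr r) powr (1 - 1 / q) = h n"
      using r h[of n] by (simp add: powr_powr r(1)[symmetric])
    ultimately have "poisson_S br x n powr (1 / q) * h n \<le> (1 / q) * poisson_S br x n + (1 - 1 / q) * h n powr r"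
      by simp
    then have "exp (- (?Q * snd x)) * f x * (poisson_S br x n powr (1 / q) * h n)
        \<le> exp (- (?Q * snd x)) * f x * ((1 / q) * poisson_S br x n + (1 - 1 / q) * h n powr r)"
      using f by (intro mult_left_mono) auto
    then have "ennreal (exp (- (?Q * snd x)) * f x * poisson_S br x n powr (1 / q) * h n)
        \<le> ennreal (exp (- (?Q * snd x)) * f x * (a * poisson_S br x n + b * h n powr r))"
      by (intro ennreal_leI) (simp add: a_def b_def mult.assoc)
    also have "\<dots> = ennreal (exp (- (?Q * snd x)) * f x) * ?Y x n"
      using f ab by (simp add: ennreal_mult ennreal_plus)
    finally show ?thesis .
  qed
  have "(\<integral>\<^sup>+n. fourier_majorant br (1 / q) f n * ennreal (h n) \<partial>lborel)
      \<le> (\<integral>\<^sup>+n. \<integral>\<^sup>+x. ennreal (exp (- (?Q * snd x)) * f x) * ?Y x n \<partial>lborel \<partial>lborel)"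
    unfolding pairing_fourier_majorant[OF assms(1-3) \<open>h \<in> borel_measurable borel\<close> h]
    by (intro nn_integral_mono *)
  also have "\<dots> = (\<integral>\<^sup>+x. \<integral>\<^sup>+n. ennreal (exp (- (?Q * snd x)) * f x) * ?Y x n \<partial>lborel \<partial>lborel)"
    by (rule nn_integral_lborel_swap) measurable
  also have "\<dots> \<le> (\<integral>\<^sup>+x. ennreal (exp (- (?Q * snd x)) * f x) * 1 \<partial>lborel)"
  proof (rule nn_integral_mono)
    fix x
    have "(\<integral>\<^sup>+n. ?Y x n \<partial>lborel) = ennreal a * 1 + ennreal b * (\<integral>\<^sup>+n. ennreal (h n powr r) \<partial>lborel)"
      by (subst nn_integral_add) (auto simp: nn_integral_cmult nn_integral_poisson_S[OF H])
    also have "\<dots> \<le> ennreal a * 1 + ennreal b * 1"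
      using h1 by (intro add_mono mult_left_mono) (auto simp: r_def)
    also have "\<dots> = 1" using ab by (simp add: ennreal_plus[symmetric] del: ennreal_plus)
    finally have "(\<integral>\<^sup>+n. ?Y x n \<partial>lborel) \<le> 1" .
    from mult_left_mono[OF this, of "ennreal (exp (- (?Q * snd x)) * f x)"]
    show "(\<integral>\<^sup>+n. ennreal (exp (- (?Q * snd x)) * f x) * ?Y x n \<partial>lborel) \<le> ennreal (exp (- (?Q * snd x)) * f x) * 1"
      by (subst nn_integral_cmult) auto
  qed
  also have "\<dots> = (\<integral>\<^sup>+x. ennreal (f x) \<partial>haar_S)"
    using f by (subst nn_integral_haar_S) (auto simp: ennreal_mult)
  finally show ?thesis using K by (rule order_trans)
qed

lemma nn_integral_scaled_kernel_translate:
  assumes H: "H_type br" and \<theta>: "1/2 < \<theta>"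
  shows "(\<integral>\<^sup>+n. ennreal (scaled_kernel t (N_mult br (- n) n1) powr \<theta>) \<partial>lborel)
    = ennreal (exp (t * Q_dim TYPE('v::euclidean_space \<times> 'z::euclidean_space)) * kernel_mass TYPE('v \<times> 'z) \<theta>)"
  and "(\<integral>\<^sup>+n1. ennreal (scaled_kernel t (N_mult br (- n) (n1 :: 'v \<times> 'z)) powr \<theta>) \<partial>lborel)
    = ennreal (exp (t * Q_dim TYPE('v::euclidean_space \<times> 'z::euclidean_space)) * kernel_mass TYPE('v \<times> 'z) \<theta>)"
  by (simp_all add: nn_integral_N_mult_left[OF H, where g="\<lambda>n. ennreal (scaled_kernel t n powr \<theta>)"]
      nn_integral_N_mult_right[OF H, where g="\<lambda>n. ennreal (scaled_kernel t n powr \<theta>)"]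
      nn_integral_scaled_kernel_eq_mass[OF \<theta>])

text \<open>
  The integrand of the bilinear form, with \<open>C0 * exp (- t Q) * D\<close> for the Poisson kernel. In terms of
  \<open>F = f powr p\<close> and \<open>v = exp (t Q) * H\<close> it is \<open>C0 powr (1 / q) * exp (- 2 Q t)\<close> times a product to
  which \<open>interpolation_inequality\<close> applies, since \<open>Q t + Q t / q + Q t (1 - 1 / q) = 2 Q t\<close>. The three resulting
  terms are grouped so that each factor \<open>exp (- Q t) * D powr \<theta>\<close> integrates over \<open>N\<close> to a constant.
\<close>

lemma pairing_Lp_bound_pointwise:
  fixes C0 Q t f h D p q \<kappa> \<theta> :: real
  assumes nn: "0 \<le> C0" "0 \<le> f" "0 \<le> h" and D: "0 < D" "D \<le> 1"
    and pq: "1 < p" "1 < q" and \<kappa>: "0 < \<kappa>" "\<kappa> < 1" and \<theta>: "0 \<le> \<theta>"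
    and e1: "1 - 1 / p \<le> (1 - 1 / q) / (1 + \<kappa>)" and e2: "(1 - 1 / q) / (1 - \<kappa>) \<le> 1"
    and e3: "\<theta> * (1 - (1 - 1 / q) / (1 + \<kappa>) + (1 - 1 / p)) \<le> 1 - (1 - 1 / q)"
  defines "H \<equiv> h powr (q / (q - 1))"
  shows "exp (- (Q * t)) * f * (C0 * exp (- (t * Q)) * D) powr (1 / q) * h
     \<le> C0 powr (1 / q) * (exp (- (Q * t)) * f powr p * (exp (- (Q * t)) * D powr \<theta>) + exp (- (Q * t)) * f powr p * H
          + H * tent \<kappa> (exp (t * Q) * H) * (exp (- (Q * t)) * D powr \<theta>))"
proof -
  let ?v = "exp (t * Q) * H" and ?F = "f powr p"
  have H0: "0 \<le> H" by (simp add: H_def)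
  have F: "?F powr (1 / p) = f" using pq nn by (simp add: powr_powr)
  have h: "h = exp (- (t * Q) * (1 - 1 / q)) * ?v powr (1 - 1 / q)"
  proof -
    have "H powr (1 - 1 / q) = h"
    proof -
      have "q / (q - 1) * (1 - 1 / q) = 1" using pq by (simp add: field_simps)
      then show ?thesis using nn by (simp only: H_def powr_powr) simp
    qed
    moreover have "?v powr (1 - 1 / q) = exp (t * Q * (1 - 1 / q)) * H powr (1 - 1 / q)"
      using H0 by (subst powr_mult) (auto simp: exp_powr_real)
    ultimately show ?thesis by (simp add: mult.assoc[symmetric] mult_exp_exp)
  qed
  have "exp (- (Q * t)) * f * (C0 * exp (- (t * Q)) * D) powr (1 / q) * h
      = C0 powr (1 / q) * (exp (- (Q * t)) * exp (- (t * Q) * (1 / q)) * exp (- (t * Q) * (1 - 1 / q)))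
          * (?F powr (1 / p) * ?v powr (1 - 1 / q) * D powr (1 / q))"
    using nn D by (subst h) (simp add: F powr_mult exp_powr_real mult_ac)
  also have "exp (- (Q * t)) * exp (- (t * Q) * (1 / q)) * exp (- (t * Q) * (1 - 1 / q)) = exp (- (2 * Q * t))"
    by (simp add: mult_exp_exp algebra_simps)
  also have "C0 powr (1 / q) * exp (- (2 * Q * t)) * (?F powr (1 / p) * ?v powr (1 - 1 / q) * D powr (1 / q))
      \<le> C0 powr (1 / q) * exp (- (2 * Q * t)) * (?F * D powr \<theta> + ?F * (?v * tent \<kappa> ?v) + ?v * tent \<kappa> ?v * D powr \<theta>)"
    using pq H0 interpolation_inequality[of ?F ?v D "1 - 1 / p" "1 - 1 / q" \<kappa> \<theta>, OF _ _ D _ _ \<kappa> e1 e2 \<theta> e3]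
    by (intro mult_left_mono) auto
  also have "\<dots> \<le> C0 powr (1 / q) * exp (- (2 * Q * t)) * (?F * D powr \<theta> + ?F * (?v * 1) + ?v * tent \<kappa> ?v * D powr \<theta>)"
    using H0 \<kappa> by (intro mult_left_mono add_mono tent_le_1) auto
  also have "\<dots> = C0 powr (1 / q) * (exp (- (Q * t)) * f powr p * (exp (- (Q * t)) * D powr \<theta>) + exp (- (Q * t)) * f powr p * H
          + H * tent \<kappa> (exp (t * Q) * H) * (exp (- (Q * t)) * D powr \<theta>))"
  proof -
    have distrib: "c * (X * X) * (F * D' + F * (Z * H * 1) + Z * H * T * D') = c * (X * F * (X * D') + X * F * H + H * T * (X * D'))"
      if "X * Z = 1" for c X Z F D' H T :: real
    proof -
      have "c * (X * X) * (F * D' + F * (Z * H * 1) + Z * H * T * D')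
          = c * (X * F * (X * D') + (X * Z) * (X * F * H) + (X * Z) * (H * T * (X * D')))"
        by (simp add: algebra_simps)
      then show ?thesis by (simp add: that)
    qed
    have "exp (- (2 * Q * t)) = exp (- (Q * t)) * exp (- (Q * t))" "exp (- (Q * t)) * exp (t * Q) = 1"
      by (simp_all add: mult_exp_exp algebra_simps)
    then show ?thesis by (simp only: distrib)
  qed
  finally show ?thesis .
qed

text \<open>
  The strong-type estimate behind part (ii). The three terms of the pointwise bound are integrated
  separately. The terms \<open>?A\<close> and \<open>?B\<close> reduce to the norm of \<open>f\<close>, after the integral of the kernel in \<open>n\<close>
  and of \<open>h\<close>, respectively. In the term \<open>?E\<close> the function \<open>f\<close> is absent: there the integral of the kernel
  in \<open>n\<^sub>1\<close> leaves an integral over \<open>t\<close>, which converges because of the tent.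
\<close>

lemma pairing_Lp_bound:
  fixes br :: "'v::euclidean_space \<times> 'z::euclidean_space \<Rightarrow> 'v \<times> 'z \<Rightarrow> 'v \<times> 'z"
  assumes H: "H_type br" and p: "1 < p" and pq: "p < q" and qp': "q < p / (p - 1)" and K: "0 \<le> K"
  obtains C where "0 \<le> C"
    "\<And>f h. f \<in> borel_measurable borel \<Longrightarrow> (\<And>x. 0 \<le> f x) \<Longrightarrow>
      (\<integral>\<^sup>+x. ennreal (f x powr p) \<partial>haar_S) \<le> ennreal K \<Longrightarrow>
      h \<in> borel_measurable borel \<Longrightarrow> (\<And>n. 0 \<le> h n) \<Longrightarrow>
      (\<integral>\<^sup>+n. ennreal (h n powr (q / (q - 1))) \<partial>lborel) \<le> 1 \<Longrightarrow>
      (\<integral>\<^sup>+n. fourier_majorant br (1 / q) f n * ennreal (h n) \<partial>lborel) \<le> ennreal C"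
proof -
  note [measurable] = measurable_poisson_S[OF H] measurable_N_mult[OF H]
  let ?Q = "Q_dim TYPE('v \<times> 'z)" and ?Pc = "poisson_const TYPE('v \<times> 'z)"
  have q: "1 < q" using p pq by simp
  obtain \<kappa> \<theta> where \<kappa>: "0 < \<kappa>" "\<kappa> < 1" and \<theta>: "1/2 < \<theta>"
    and e: "1 - 1 / p \<le> (1 - 1 / q) / (1 + \<kappa>)" "(1 - 1 / q) / (1 - \<kappa>) \<le> 1"
      "\<theta> * (1 - (1 - 1 / q) / (1 + \<kappa>) + (1 - 1 / p)) \<le> 1 - (1 - 1 / q)"
  proof (rule interpolation_parameters)
    show "0 < 1 - 1 / p" using p by simp
    show "1 - 1 / p < 1 - 1 / q" using p pq by (simp add: frac_less2)
    have "q * (p - 1) < p" using p qp' by (simp add: pos_less_divide_eq)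
    then show "1 - 1 / p + (1 - 1 / q) < 1" using p q by (simp add: field_simps)
  qed
  define c where "c = kernel_mass TYPE('v \<times> 'z) \<theta>"
  define \<tau> where "\<tau> = tent_mass (\<kappa> * ?Q)"
  have c: "0 \<le> c" and \<tau>: "0 \<le> \<tau>" by (simp_all add: c_def kernel_mass_def \<tau>_def tent_mass_def)
  let ?C = "?Pc powr (1 / q) * (c * K + K + c * \<tau>)"
  have "(\<integral>\<^sup>+n. fourier_majorant br (1 / q) f n * ennreal (h n) \<partial>lborel) \<le> ennreal ?C"
    if [measurable]: "f \<in> borel_measurable borel" and f: "\<And>x. 0 \<le> f x"
      and fK: "(\<integral>\<^sup>+x. ennreal (f x powr p) \<partial>haar_S) \<le> ennreal K"
      and [measurable]: "h \<in> borel_measurable borel" and h: "\<And>n. 0 \<le> h n"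
      and h1: "(\<integral>\<^sup>+n. ennreal (h n powr (q / (q - 1))) \<partial>lborel) \<le> 1" for f h
  proof -
    define G where "G n = h n powr (q / (q - 1))" for n
    define D where "D x n = scaled_kernel (snd x) (N_mult br (- n) (fst x)) powr \<theta>" for x :: "('v, 'z) DR" and n
    define F where "F x = exp (- (?Q * snd x)) * f x powr p" for x
    have [measurable]: "G \<in> borel_measurable borel" "F \<in> borel_measurable borel" unfolding G_def F_def by measurable
    have [measurable]: "(\<lambda>y. D (u y) (w y)) \<in> borel_measurable M"
      if [measurable]: "u \<in> borel_measurable M" "w \<in> borel_measurable M" for u w and M :: "'b measure"
      unfolding D_def by measurable
    have nn: "0 \<le> G n" "0 \<le> D x n" "0 \<le> F x" for n x by (simp_all add: G_def D_def F_def)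
    have FK: "(\<integral>\<^sup>+x. ennreal (F x) \<partial>lborel) \<le> ennreal K"
      using fK by (subst (asm) nn_integral_haar_S) (auto simp: F_def ennreal_mult)
    let ?A = "\<lambda>n x. ennreal (F x) * (ennreal (exp (- (?Q * snd x))) * ennreal (D x n))"
    let ?B = "\<lambda>n x. ennreal (F x) * ennreal (G n)"
    let ?E = "\<lambda>n x. ennreal (G n * tent \<kappa> (exp (snd x * ?Q) * G n)) * (ennreal (exp (- (?Q * snd x))) * ennreal (D x n))"
    have kernel_n: "ennreal (exp (- (?Q * t))) * (\<integral>\<^sup>+n. ennreal (D (n1, t) n) \<partial>lborel) = ennreal c"
      and kernel_x: "ennreal (exp (- (?Q * t))) * (\<integral>\<^sup>+n1. ennreal (D (n1, t) n) \<partial>lborel) = ennreal c" for n1 n and t :: real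
      using c by (simp_all add: D_def nn_integral_scaled_kernel_translate[OF H \<theta>] c_def[symmetric] ennreal_mult[symmetric]
          mult.assoc[symmetric] mult_exp_exp mult.commute[of t])
    have A: "(\<integral>\<^sup>+n. \<integral>\<^sup>+x. ?A n x \<partial>lborel \<partial>lborel) \<le> ennreal (c * K)"
    proof -
      have "(\<integral>\<^sup>+n. \<integral>\<^sup>+x. ?A n x \<partial>lborel \<partial>lborel) = (\<integral>\<^sup>+x. \<integral>\<^sup>+n. ?A n x \<partial>lborel \<partial>lborel)"
        by (rule nn_integral_lborel_swap) measurable
      also have "\<dots> = (\<integral>\<^sup>+x. ennreal (F x) * ennreal c \<partial>lborel)"
        using kernel_n by (intro nn_integral_cong) (auto simp: nn_integral_cmult)
      also have "\<dots> = (\<integral>\<^sup>+x. ennreal (F x) \<partial>lborel) * ennreal c"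
        by (rule nn_integral_multc) simp
      also have "\<dots> \<le> ennreal K * ennreal c" by (intro mult_right_mono FK) simp
      finally show ?thesis using K c by (simp add: ennreal_mult[symmetric] mult.commute)
    qed
    have B: "(\<integral>\<^sup>+n. \<integral>\<^sup>+x. ?B n x \<partial>lborel \<partial>lborel) \<le> ennreal K"
    proof -
      have "(\<integral>\<^sup>+n. \<integral>\<^sup>+x. ?B n x \<partial>lborel \<partial>lborel) = (\<integral>\<^sup>+x. ennreal (F x) \<partial>lborel) * (\<integral>\<^sup>+n. ennreal (G n) \<partial>lborel)"
        by (simp add: nn_integral_multc nn_integral_cmult)
      also have "\<dots> \<le> ennreal K * 1" using FK h1 by (intro mult_mono) (auto simp: G_def)
      finally show ?thesis by simp
    qed
    have E: "(\<integral>\<^sup>+n. \<integral>\<^sup>+x. ?E n x \<partial>lborel \<partial>lborel) \<le> ennreal (c * \<tau>)"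
    proof -
      have "(\<integral>\<^sup>+x. ?E n x \<partial>lborel) = ennreal (G n) * ennreal (c * \<tau>)" for n
      proof -
        have "(\<integral>\<^sup>+x. ?E n x \<partial>lborel) = (\<integral>\<^sup>+n1. \<integral>\<^sup>+t. ?E n (n1, t) \<partial>lborel \<partial>lborel)"
          by (rule nn_integral_lborel_pair) measurable
        also have "\<dots> = (\<integral>\<^sup>+t. \<integral>\<^sup>+n1. ?E n (n1, t) \<partial>lborel \<partial>lborel)"
          by (rule nn_integral_lborel_swap) measurable
        also have "\<dots> = (\<integral>\<^sup>+t. ennreal (G n * tent \<kappa> (exp (t * ?Q) * G n)) * ennreal c \<partial>lborel)"
          using kernel_x by (intro nn_integral_cong) (simp add: nn_integral_cmult)
        also have "\<dots> = ennreal (G n * \<tau>) * ennreal c"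
          using nn_integral_tent[OF \<kappa>(1) Q_dim_pos[where 'v='v and 'z='z] nn(1)] by (simp add: nn_integral_multc \<tau>_def)
        finally show ?thesis using nn c \<tau> by (simp add: ennreal_mult[symmetric] mult_ac)
      qed
      then have "(\<integral>\<^sup>+n. \<integral>\<^sup>+x. ?E n x \<partial>lborel \<partial>lborel) = (\<integral>\<^sup>+n. ennreal (G n) \<partial>lborel) * ennreal (c * \<tau>)"
        by (simp add: nn_integral_multc)
      also have "\<dots> \<le> 1 * ennreal (c * \<tau>)" using h1 by (intro mult_right_mono) (auto simp: G_def)
      finally show ?thesis by simp
    qed
    have "(\<integral>\<^sup>+n. fourier_majorant br (1 / q) f n * ennreal (h n) \<partial>lborel)
       \<le> (\<integral>\<^sup>+n. \<integral>\<^sup>+x. ennreal (?Pc powr (1 / q)) * (?A n x + ?B n x + ?E n x) \<partial>lborel \<partial>lborel)"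
      unfolding pairing_fourier_majorant[OF H \<open>f \<in> borel_measurable borel\<close> f \<open>h \<in> borel_measurable borel\<close> h]
    proof (intro nn_integral_mono)
      fix n and x :: "('v, 'z) DR"
      have "exp (- (?Q * snd x)) * f x * poisson_S br x n powr (1 / q) * h n
        \<le> ?Pc powr (1 / q) * (F x * (exp (- (?Q * snd x)) * D x n) + F x * G n
           + (G n * tent \<kappa> (exp (snd x * ?Q) * G n)) * (exp (- (?Q * snd x)) * D x n))"
        using pairing_Lp_bound_pointwise[where Q="?Q" and t="snd x" and D="scaled_kernel (snd x) (N_mult br (- n) (fst x))",
             OF less_imp_le[OF poisson_const_pos[where 'v='v and 'z='z]] f[of x] h[of n]
             scaled_kernel_pos scaled_kernel_le_1 p q \<kappa> _ e] \<theta>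
        by (simp add: poisson_S_eq poisson_eq_scaled_kernel F_def D_def G_def mult_ac)
      then have "ennreal (exp (- (?Q * snd x)) * f x * poisson_S br x n powr (1 / q) * h n)
        \<le> ennreal (?Pc powr (1 / q) * (F x * (exp (- (?Q * snd x)) * D x n) + F x * G n
           + (G n * tent \<kappa> (exp (snd x * ?Q) * G n)) * (exp (- (?Q * snd x)) * D x n)))"
        by (rule ennreal_leI)
      then show "ennreal (exp (- (?Q * snd x)) * f x * poisson_S br x n powr (1 / q) * h n)
        \<le> ennreal (?Pc powr (1 / q)) * (?A n x + ?B n x + ?E n x)"
        using nn by (simp add: ennreal_mult ennreal_plus)
    qed
    also have "\<dots> = ennreal (?Pc powr (1 / q)) * ((\<integral>\<^sup>+n. \<integral>\<^sup>+x. ?A n x \<partial>lborel \<partial>lborel)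
        + (\<integral>\<^sup>+n. \<integral>\<^sup>+x. ?B n x \<partial>lborel \<partial>lborel) + (\<integral>\<^sup>+n. \<integral>\<^sup>+x. ?E n x \<partial>lborel \<partial>lborel))"
    proof -
      have [measurable]: "(\<lambda>n. \<integral>\<^sup>+x. g n x \<partial>lborel) \<in> borel_measurable borel"
        if "(\<lambda>z. g (fst z) (snd z)) \<in> borel_measurable borel" for g :: "'v \<times> 'z \<Rightarrow> ('v, 'z) DR \<Rightarrow> ennreal"
        using borel_measurable_nn_integral_pair[OF that] by simp
      show ?thesis by (simp add: nn_integral_cmult nn_integral_add)
    qed
    also have "\<dots> \<le> ennreal (?Pc powr (1 / q)) * (ennreal (c * K) + ennreal K + ennreal (c * \<tau>))"
      by (intro mult_left_mono add_mono A B E) simp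
    also have "\<dots> = ennreal ?C" using K c \<tau> by (simp add: ennreal_mult ennreal_plus)
    finally show ?thesis .
  qed
  moreover have "0 \<le> ?C" using K c \<tau> by simp
  ultimately show thesis using that by blast
qed

section \<open>Bounds for the Fourier transform\<close>

lemma norm_poisson_pow:
  fixes br :: "'v::euclidean_space \<times> 'z::euclidean_space \<Rightarrow> 'v \<times> 'z \<Rightarrow> 'v \<times> 'z"
  shows "norm (poisson_pow br (Complex \<alpha> (\<gamma> * rho TYPE('v \<times> 'z))) x n) = poisson_S br x n powr ((1 + \<gamma>) / 2)"
proof -
  define w where "w = 1/2 - \<i> * Complex \<alpha> (\<gamma> * rho TYPE('v \<times> 'z)) / complex_of_real (Q_dim TYPE('v \<times> 'z))"
  have "Re w = (1 + \<gamma>) / 2"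
    using Q_dim_pos[where 'v='v and 'z='z] by (simp add: w_def rho_def field_simps)
  moreover have "norm (complex_of_real (poisson_S br x n) powr w) = poisson_S br x n powr Re w"
    by (subst norm_powr_real_powr) auto
  ultimately show ?thesis
    unfolding poisson_pow_def w_def[symmetric] by (simp only:)
qed

text \<open>
  As \<open>P\<close> is positive, \<open>P powr z\<close> is \<open>exp (z * ln P)\<close> with the real logarithm; this avoids the branch cut
  of the complex logarithm.
\<close>

lemma measurable_poisson_pow:
  fixes f :: "'a \<Rightarrow> ('v::euclidean_space, 'z::euclidean_space) DR"
  assumes H: "H_type br" and [measurable]: "f \<in> borel_measurable M" "g \<in> borel_measurable M"
  shows "(\<lambda>y. poisson_pow br \<zeta> (f y) (g y)) \<in> borel_measurable M"
proof -
  note [measurable] = measurable_poisson_S[OF H]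
  have "poisson_pow br \<zeta> x n = exp ((1/2 - \<i> * \<zeta> / complex_of_real (Q_dim TYPE('v \<times> 'z))) * complex_of_real (ln (poisson_S br x n)))" for x n
    using less_imp_neq[OF poisson_S_pos[of br x n]] by (simp add: poisson_pow_def powr_def Ln_of_real)
  then show ?thesis by simp
qed

lemma fourier_measurable:
  fixes br :: "'v::euclidean_space \<times> 'z::euclidean_space \<Rightarrow> 'v \<times> 'z \<Rightarrow> 'v \<times> 'z"
  assumes H: "H_type br" and f: "f \<in> borel_measurable haar_S"
  shows "fourier br f \<zeta> \<in> borel_measurable lborel"
proof -
  note [measurable] = measurable_poisson_pow[OF H] f[unfolded borel_measurable_haar_S]
  have "fourier br f \<zeta> = (\<lambda>n. \<integral>x. exp (- (Q_dim TYPE('v \<times> 'z) * snd x)) *\<^sub>R (f x * poisson_pow br \<zeta> x n) \<partial>lborel)"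
    unfolding fourier_def haar_S_def haar_density by (intro ext integral_density) auto
  also have "\<dots> \<in> borel_measurable lborel"
  proof (rule lborel.borel_measurable_lebesgue_integral)
    have "(\<lambda>z. exp (- (Q_dim TYPE('v \<times> 'z) * snd (snd z))) *\<^sub>R (f (snd z) * poisson_pow br \<zeta> (snd z) (fst z))) \<in> borel_measurable borel"
      by measurable
    then show "(\<lambda>(n, x). exp (- (Q_dim TYPE('v \<times> 'z) * snd x)) *\<^sub>R (f x * poisson_pow br \<zeta> x n)) \<in> borel_measurable (lborel \<Otimes>\<^sub>M lborel)"
      by (simp add: lborel_prod case_prod_beta)
  qed
  finally show ?thesis .
qed

lemma fourier_le_majorant:
  fixes br :: "'v::euclidean_space \<times> 'z::euclidean_space \<Rightarrow> 'v \<times> 'z \<Rightarrow> 'v \<times> 'z" and \<alpha> :: real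
  assumes H: "H_type br" and f: "f \<in> borel_measurable haar_S" and e: "e = (1 + \<gamma>) / 2"
  defines "\<zeta> \<equiv> Complex \<alpha> (\<gamma> * rho TYPE('v \<times> 'z))"
  shows fourier_converges_if_majorant_finite:
      "fourier_majorant br e (\<lambda>x. norm (f x)) n < \<infinity> \<Longrightarrow> fourier_converges br f \<zeta> n"
    and norm_fourier_le_majorant: "ennreal (norm (fourier br f \<zeta> n)) \<le> fourier_majorant br e (\<lambda>x. norm (f x)) n"
proof -
  note [measurable] = measurable_poisson_pow[OF H] f[unfolded borel_measurable_haar_S]
  have m: "(\<lambda>x. f x * poisson_pow br \<zeta> x n) \<in> borel_measurable haar_S"
    unfolding borel_measurable_haar_S by measurable
  have N: "(\<integral>\<^sup>+x. ennreal (norm (f x * poisson_pow br \<zeta> x n)) \<partial>haar_S) = fourier_majorant br e (\<lambda>x. norm (f x)) n"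
    by (simp add: fourier_majorant_def norm_mult norm_poisson_pow \<zeta>_def e)
  show "fourier_converges br f \<zeta> n" if "fourier_majorant br e (\<lambda>x. norm (f x)) n < \<infinity>"
    unfolding fourier_converges_def integrable_iff_bounded using m that by (simp add: N)
  show "ennreal (norm (fourier br f \<zeta> n)) \<le> fourier_majorant br e (\<lambda>x. norm (f x)) n"
  proof (cases "integrable haar_S (\<lambda>x. f x * poisson_pow br \<zeta> x n)")
    case True
    then show ?thesis
      unfolding fourier_def N[symmetric] by (rule integral_norm_bound_ennreal)
  qed (simp add: fourier_def not_integrable_integral_eq)
qed

lemma Lq_norm_le:
  assumes q: "1 \<le> q" and C: "0 \<le> C"
    and I: "(\<integral>\<^sup>+x. ennreal (norm (g x) powr q) \<partial>M) \<le> ennreal (C powr q)"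
  shows "Lq_norm M (ennreal q) g \<le> ennreal C"
proof -
  obtain i where i: "(\<integral>\<^sup>+x. ennreal (norm (g x) powr q) \<partial>M) = ennreal i" "0 \<le> i" "i \<le> C powr q"
    using I by (cases "\<integral>\<^sup>+x. ennreal (norm (g x) powr q) \<partial>M") (auto simp: top_unique)
  have "i powr (1 / q) \<le> (C powr q) powr (1 / q)" using i q by (intro powr_mono2) auto
  also have "\<dots> = C" using q C by (simp add: powr_powr)
  finally show ?thesis
    using q i by (simp add: Lq_norm_def ennreal_powr_def ennreal_leI)
qed

lemma fourier_Lq_bound_by_pairing:
  fixes br :: "'v::euclidean_space \<times> 'z::euclidean_space \<Rightarrow> 'v \<times> 'z \<Rightarrow> 'v \<times> 'z" and \<alpha> :: real
  assumes H: "H_type br" and f: "f \<in> borel_measurable haar_S" and q: "1 < q" and C: "0 \<le> C"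
    and dual: "\<And>h. h \<in> borel_measurable borel \<Longrightarrow> (\<And>n. 0 \<le> h n) \<Longrightarrow>
      (\<integral>\<^sup>+n. ennreal (h n powr (q / (q - 1))) \<partial>lborel) \<le> 1 \<Longrightarrow>
      (\<integral>\<^sup>+n. fourier_majorant br (1 / q) (\<lambda>x. norm (f x)) n * ennreal (h n) \<partial>lborel) \<le> ennreal C"
  defines "\<zeta> \<equiv> Complex \<alpha> (gamma_exp (ennreal q) * rho TYPE('v \<times> 'z))"
  shows "AE n in lborel. fourier_converges br f \<zeta> n"
    and "Lq_norm lborel (ennreal q) (fourier br f \<zeta>) \<le> ennreal C"
proof -
  let ?F = "fourier_majorant br (1 / q) (\<lambda>x. norm (f x))"
  have fm: "(\<lambda>x. norm (f x)) \<in> borel_measurable borel"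
    using f unfolding borel_measurable_haar_S by measurable
  have Fm: "?F \<in> borel_measurable borel"
    by (rule measurable_fourier_majorant[OF H fm]) simp
  have e: "1 / q = (1 + gamma_exp (ennreal q)) / 2"
    using q by (simp add: gamma_exp_def)
  have fin: "AE n in lborel. ?F n < \<infinity>"
    by (rule nn_integral_powr_le_by_duality(1)[OF Fm q C]) (rule dual)
  have bound: "(\<integral>\<^sup>+n. ennreal (enn2real (?F n) powr q) \<partial>lborel) \<le> ennreal (C powr q)"
    by (rule nn_integral_powr_le_by_duality(2)[OF Fm q C]) (rule dual)
  show "AE n in lborel. fourier_converges br f \<zeta> n"
    using fin unfolding \<zeta>_def by eventually_elim (rule fourier_converges_if_majorant_finite[OF H f e])
  have "(\<integral>\<^sup>+n. ennreal (norm (fourier br f \<zeta> n) powr q) \<partial>lborel) \<le> (\<integral>\<^sup>+n. ennreal (enn2real (?F n) powr q) \<partial>lborel)"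
  proof (rule nn_integral_mono_AE)
    show "AE n in lborel. ennreal (norm (fourier br f \<zeta> n) powr q) \<le> ennreal (enn2real (?F n) powr q)"
      using fin
    proof eventually_elim
      case (elim n)
      then have "norm (fourier br f \<zeta> n) \<le> enn2real (?F n)"
        using enn2real_mono[OF norm_fourier_le_majorant[OF H f e, of \<alpha> n]] by (simp add: \<zeta>_def)
      then show ?case using q by (intro ennreal_leI powr_mono2) auto
    qed
  qed
  then show "Lq_norm lborel (ennreal q) (fourier br f \<zeta>) \<le> ennreal C"
    using bound q C by (intro Lq_norm_le) auto
qed

text \<open>
  For \<open>1 < q < \<infinity>\<close> the pairing bound applies. For \<open>q = \<infinity>\<close> the kernel is raised to the power 0 and the
  majorant is the constant \<open>L\<^sup>1\<close> norm of \<open>f\<close>. For \<open>q = 1\<close> the dual exponent is infinite, and Tonelli's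
  theorem with the normalisation of the Poisson kernel gives the integral of the majorant directly.
\<close>

lemma fourier_L1_bound:
  fixes br :: "'v::euclidean_space \<times> 'z::euclidean_space \<Rightarrow> 'v \<times> 'z \<Rightarrow> 'v \<times> 'z" and \<alpha> :: real
  assumes H: "H_type br" and int: "integrable haar_S f" and q: "1 \<le> q"
  defines "\<zeta> \<equiv> Complex \<alpha> (gamma_exp q * rho TYPE('v \<times> 'z))"
  shows "AE n in lborel. fourier_converges br f \<zeta> n"
    and "Lq_norm lborel q (fourier br f \<zeta>) \<le> ennreal (\<integral>x. norm (f x) \<partial>haar_S)"
proof -
  let ?K = "\<integral>x. norm (f x) \<partial>haar_S"
  have f: "f \<in> borel_measurable haar_S" using int by simp
  have fm: "(\<lambda>x. norm (f x)) \<in> borel_measurable borel"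
    using f unfolding borel_measurable_haar_S by measurable
  have K: "(\<integral>\<^sup>+x. ennreal (norm (f x)) \<partial>haar_S) = ennreal ?K"
    using int by (intro nn_integral_eq_integral) auto
  consider "q = \<infinity>" | "q = 1" | r where "q = ennreal r" "1 < r"
  proof (cases q)
    case (real r)
    then show ?thesis using q that(2)[OF _] that(3)[of r] by (cases "r = 1") (auto simp: ennreal_1[symmetric] simp del: ennreal_1)
  qed (use that in simp)
  then have "(AE n in lborel. fourier_converges br f \<zeta> n) \<and> Lq_norm lborel q (fourier br f \<zeta>) \<le> ennreal ?K"
  proof cases
    case 1
    have e: "0 = (1 + gamma_exp q) / 2" using 1 by (simp add: gamma_exp_def)
    have maj: "fourier_majorant br 0 (\<lambda>x. norm (f x)) n = ennreal ?K" for n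
      using K by (simp add: fourier_majorant_def less_imp_neq[OF poisson_S_pos, THEN not_sym])
    have "fourier_converges br f \<zeta> n" for n
      unfolding \<zeta>_def by (rule fourier_converges_if_majorant_finite[OF H f e]) (simp add: maj)
    moreover have "esssup lborel (\<lambda>n. ennreal (norm (fourier br f \<zeta> n))) \<le> ennreal ?K"
      using fourier_measurable[OF H f, of \<zeta>] norm_fourier_le_majorant[OF H f e, of \<alpha>]
      by (intro esssup_I) (auto simp: maj \<zeta>_def)
    ultimately show ?thesis using 1 by (simp add: Lq_norm_def)
  next
    case 2
    have e: "1 = (1 + gamma_exp q) / 2" using 2 by (simp add: gamma_exp_def)
    let ?F = "fourier_majorant br 1 (\<lambda>x. norm (f x))"
    have Fm: "?F \<in> borel_measurable borel"
      by (rule measurable_fourier_majorant[OF H fm]) simp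
    have "(\<integral>\<^sup>+n. ?F n \<partial>lborel) = ennreal ?K"
    proof -
      let ?Q = "Q_dim TYPE('v \<times> 'z)"
      note [measurable] = measurable_poisson_S[OF H] fm
      have "(\<integral>\<^sup>+n. ?F n \<partial>lborel) = (\<integral>\<^sup>+n. \<integral>\<^sup>+x. ennreal (exp (- (?Q * snd x)) * norm (f x)) * ennreal (poisson_S br x n) \<partial>lborel \<partial>lborel)"
        by (simp add: fourier_majorant_eq_lborel[OF H fm] ennreal_mult)
      also have "\<dots> = (\<integral>\<^sup>+x. \<integral>\<^sup>+n. ennreal (exp (- (?Q * snd x)) * norm (f x)) * ennreal (poisson_S br x n) \<partial>lborel \<partial>lborel)"
        by (rule nn_integral_lborel_swap) measurable
      also have "\<dots> = (\<integral>\<^sup>+x. ennreal (exp (- (?Q * snd x)) * norm (f x)) \<partial>lborel)"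
        by (simp add: nn_integral_cmult nn_integral_poisson_S[OF H])
      also have "\<dots> = (\<integral>\<^sup>+x. ennreal (norm (f x)) \<partial>haar_S)"
        by (subst nn_integral_haar_S) (auto simp: ennreal_mult)
      finally show ?thesis by (simp add: K)
    qed
    note I = this
    have "AE n in lborel. ?F n \<noteq> \<infinity>"
      using Fm by (intro nn_integral_PInf_AE) (auto simp: I)
    then have "AE n in lborel. fourier_converges br f \<zeta> n"
      unfolding \<zeta>_def by eventually_elim (rule fourier_converges_if_majorant_finite[OF H f e], simp add: less_top)
    moreover have "Lq_norm lborel (ennreal 1) (fourier br f \<zeta>) \<le> ennreal ?K"
    proof (rule Lq_norm_le)
      have "(\<integral>\<^sup>+n. ennreal (norm (fourier br f \<zeta> n) powr 1) \<partial>lborel) \<le> (\<integral>\<^sup>+n. ?F n \<partial>lborel)"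
        using norm_fourier_le_majorant[OF H f e, of \<alpha>] by (intro nn_integral_mono) (simp add: \<zeta>_def)
      then show "(\<integral>\<^sup>+n. ennreal (norm (fourier br f \<zeta> n) powr 1) \<partial>lborel) \<le> ennreal (?K powr 1)"
        by (simp add: I)
    qed simp_all
    ultimately show ?thesis using 2 by simp
  next
    case 3
    have dual: "(\<integral>\<^sup>+n. fourier_majorant br (1 / r) (\<lambda>x. norm (f x)) n * ennreal (h n) \<partial>lborel) \<le> ennreal ?K"
      if "h \<in> borel_measurable borel" "\<And>n. 0 \<le> h n" "(\<integral>\<^sup>+n. ennreal (h n powr (r / (r - 1))) \<partial>lborel) \<le> 1" for h
      using that K 3 by (intro pairing_L1_bound[OF H fm]) auto
    have "0 \<le> ?K" by simp
    from fourier_Lq_bound_by_pairing[OF H f 3(2) this dual, of \<alpha>] show ?thesis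
      using 3 by (simp add: \<zeta>_def)
  qed
  then show "AE n in lborel. fourier_converges br f \<zeta> n"
    and "Lq_norm lborel q (fourier br f \<zeta>) \<le> ennreal ?K" by auto
qed

text \<open>
  The function \<open>g = norm \<circ> f / W\<close> is split at height 1. Its large values form an integrable function, to
  which the bound for \<open>L\<^sup>1\<close> applies; its small values form a function in \<open>L\<^sup>r\<close> for an exponent \<open>r > p\<close> so
  close to \<open>p\<close> that \<open>r < q < r / (r - 1)\<close> still holds, and \<open>pairing_Lp_bound\<close> applies.
\<close>

lemma fourier_weak_Lp_bound:
  fixes br :: "'v::euclidean_space \<times> 'z::euclidean_space \<Rightarrow> 'v \<times> 'z \<Rightarrow> 'v \<times> 'z"
  assumes H: "H_type br" and p: "1 < p" and pq: "p < q" and qp': "q < p / (p - 1)"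
  obtains C where "0 < C"
    "\<And>f \<alpha> W. f \<in> borel_measurable haar_S \<Longrightarrow> 0 < W \<Longrightarrow> weak_norm haar_S p f \<le> ennreal W \<Longrightarrow>
      (AE n in lborel. fourier_converges br f (Complex \<alpha> (gamma_exp (ennreal q) * rho TYPE('v \<times> 'z))) n) \<and>
      Lq_norm lborel (ennreal q) (fourier br f (Complex \<alpha> (gamma_exp (ennreal q) * rho TYPE('v \<times> 'z)))) \<le> ennreal (C * W)"
proof -
  have q: "1 < q" using p pq by simp
  define q' where "q' = q / (q - 1)"
  define r where "r = (p + min q q') / 2"
  have "p < q'"
    using p q qp' by (simp add: q'_def field_simps)
  then have r: "p < r" "r < q" "r < q'" using pq by (auto simp: r_def)
  then have "1 < r" using p by simp
  moreover from this have "q < r / (r - 1)" using r(3) q by (simp add: q'_def field_simps)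
  ultimately have r': "1 < r" "q < r / (r - 1)" .
  define K0 where "K0 = 2 powr p / (1 - 2 powr (p - r))"
  define K1 where "K1 = 2 / (1 - 2 powr (1 - p))"
  have "2 powr (p - r) < (1::real)" "2 powr (1 - p) < (1::real)"
    using r p powr_less_mono[of "p - r" 0 2] powr_less_mono[of "1 - p" 0 2] by simp_all
  then have K: "0 \<le> K0" "0 < K1" by (simp_all add: K0_def K1_def)
  obtain C0 where C0: "0 \<le> C0" and small: "\<And>f h. f \<in> borel_measurable borel \<Longrightarrow> (\<And>x. 0 \<le> f x) \<Longrightarrow>
      (\<integral>\<^sup>+x. ennreal (f x powr r) \<partial>haar_S) \<le> ennreal K0 \<Longrightarrow>
      h \<in> borel_measurable borel \<Longrightarrow> (\<And>n. 0 \<le> h n) \<Longrightarrow>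
      (\<integral>\<^sup>+n. ennreal (h n powr (q / (q - 1))) \<partial>lborel) \<le> 1 \<Longrightarrow>
      (\<integral>\<^sup>+n. fourier_majorant br (1 / q) f n * ennreal (h n) \<partial>lborel) \<le> ennreal C0"
    using pairing_Lp_bound[OF H r'(1) r(2) r'(2) K(1)] by blast
  have main: "(\<integral>\<^sup>+n. fourier_majorant br (1 / q) (\<lambda>x. norm (f x)) n * ennreal (h n) \<partial>lborel) \<le> ennreal ((K1 + C0) * W)"
    if f: "f \<in> borel_measurable haar_S" and W: "0 < W" "weak_norm haar_S p f \<le> ennreal W"
      and h: "h \<in> borel_measurable borel" "\<And>n. 0 \<le> h n" "(\<integral>\<^sup>+n. ennreal (h n powr (q / (q - 1))) \<partial>lborel) \<le> 1" for f :: "('v, 'z) DR \<Rightarrow> complex" and W h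
  proof -
    define g where "g x = norm (f x) / W" for x
    define g0 where "g0 x = (if g x \<le> 1 then g x else 0)" for x
    define g1 where "g1 x = (if 1 < g x then g x else 0)" for x
    have [measurable]: "f \<in> borel_measurable borel" using f by (simp add: borel_measurable_haar_S)
    have gm [measurable]: "g \<in> borel_measurable borel" unfolding g_def by measurable
    have m [measurable]: "g0 \<in> borel_measurable borel" "g1 \<in> borel_measurable borel"
      unfolding g0_def g1_def by measurable
    have g: "0 \<le> g x" for x using W by (simp add: g_def)
    then have nn: "0 \<le> g0 x" "0 \<le> g1 x" for x by (simp_all add: g0_def g1_def)
    have mu: "emeasure haar_S {x \<in> space haar_S. s < g x} \<le> ennreal (s powr (- p))" if "0 < s" for s
    proof -
      have "emeasure haar_S {x \<in> space haar_S. s * W < norm (f x)} \<le> ennreal ((W / (s * W)) powr p)"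
        using W p that by (intro emeasure_superlevel_le_weak_norm f) auto
      moreover have "(W / (s * W)) powr p = s powr (- p)"
      proof -
        have "W / (s * W) = 1 / s" using W by simp
        then show ?thesis using that by (simp add: powr_divide powr_minus_divide)
      qed
      ultimately show ?thesis using W by (simp add: g_def pos_less_divide_eq)
    qed
    have gh: "g \<in> borel_measurable haar_S" by (simp add: borel_measurable_haar_S)
    have I1: "(\<integral>\<^sup>+x. ennreal (g1 x) \<partial>haar_S) \<le> ennreal K1"
      using nn_integral_large_values_le[OF gh p mu] by (simp add: g1_def K1_def)
    have I0: "(\<integral>\<^sup>+x. ennreal (g0 x powr r) \<partial>haar_S) \<le> ennreal K0"
      using nn_integral_small_values_le[OF gh g _ r(1) mu] p by (simp add: g0_def K0_def)
    let ?M = "fourier_majorant br (1 / q)"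
    have Mm [measurable]: "?M g0 \<in> borel_measurable borel" "?M g1 \<in> borel_measurable borel"
      by (intro measurable_fourier_majorant[OF H] m nn)+
    have split: "?M (\<lambda>x. norm (f x)) n = ennreal W * (?M g1 n + ?M g0 n)" for n
    proof -
      note [measurable] = measurable_poisson_S[OF H]
      have m': "(\<lambda>x. ennreal (g1 x * poisson_S br x n powr (1 / q))) \<in> borel_measurable haar_S"
        "(\<lambda>x. ennreal (g0 x * poisson_S br x n powr (1 / q))) \<in> borel_measurable haar_S"
        unfolding borel_measurable_haar_S by measurable
      have "norm (f x) = W * (g1 x + g0 x)" for x
        using W by (auto simp: g_def g0_def g1_def)
      then have "ennreal (norm (f x) * poisson_S br x n powr (1 / q))
         = ennreal W * (ennreal (g1 x * poisson_S br x n powr (1 / q)) + ennreal (g0 x * poisson_S br x n powr (1 / q)))" for x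
        using W nn by (simp add: ennreal_plus[symmetric] ennreal_mult[symmetric] algebra_simps del: ennreal_plus)
      then show ?thesis
        unfolding fourier_majorant_def using m' by (simp add: nn_integral_cmult nn_integral_add)
    qed
    have "(\<integral>\<^sup>+n. ?M (\<lambda>x. norm (f x)) n * ennreal (h n) \<partial>lborel)
       = ennreal W * ((\<integral>\<^sup>+n. ?M g1 n * ennreal (h n) \<partial>lborel) + (\<integral>\<^sup>+n. ?M g0 n * ennreal (h n) \<partial>lborel))"
      using h(1) by (simp add: split distrib_right mult.assoc nn_integral_cmult nn_integral_add)
    also have "\<dots> \<le> ennreal W * (ennreal K1 + ennreal C0)"
      by (intro mult_left_mono add_mono pairing_L1_bound[OF H m(2) nn(2) I1 q h] small[OF m(1) nn(1) I0 h]) simp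
    also have "\<dots> = ennreal ((K1 + C0) * W)"
      using W K C0 by (simp add: ennreal_plus[symmetric] ennreal_mult[symmetric] mult.commute del: ennreal_plus)
    finally show ?thesis .
  qed
  show thesis
  proof (rule that)
    show "0 < K1 + C0" using K C0 by simp
    fix f :: "('v, 'z) DR \<Rightarrow> complex" and \<alpha> W
    assume f: "f \<in> borel_measurable haar_S" and W: "0 < W" "weak_norm haar_S p f \<le> ennreal W"
    have "0 \<le> (K1 + C0) * W" using K C0 W by simp
    from fourier_Lq_bound_by_pairing[OF H f q this main[OF f W], of \<alpha>]
    show "(AE n in lborel. fourier_converges br f (Complex \<alpha> (gamma_exp (ennreal q) * rho TYPE('v \<times> 'z))) n) \<and>
      Lq_norm lborel (ennreal q) (fourier br f (Complex \<alpha> (gamma_exp (ennreal q) * rho TYPE('v \<times> 'z)))) \<le> ennreal ((K1 + C0) * W)"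
      by blast
  qed
qed

theorem theorem3p3:
  fixes br :: "'v::euclidean_space \<times> 'z::euclidean_space \<Rightarrow> 'v \<times> 'z \<Rightarrow> 'v \<times> 'z"
  assumes "H_type br"
  shows
    "(\<forall>f q \<alpha>. integrable haar_S f \<longrightarrow> 1 \<le> q \<longrightarrow>
        (let \<zeta> = Complex \<alpha> (gamma_exp q * rho TYPE('v \<times> 'z)) in
          (AE n in lborel. fourier_converges br f \<zeta> n) \<and>
          fourier br f \<zeta> \<in> borel_measurable lborel \<and>
          Lq_norm lborel q (fourier br f \<zeta>) \<le> ennreal (\<integral>x. norm (f x) \<partial>haar_S)))
     \<and>
     (\<forall>p q :: real. 1 < p \<longrightarrow> p < 2 \<longrightarrow> p < q \<longrightarrow> q < p / (p - 1) \<longrightarrow>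
        (\<exists>C :: real. \<forall>f \<alpha>. f \<in> weak_Lp haar_S p \<longrightarrow>
          (let \<zeta> = Complex \<alpha> (gamma_exp (ennreal q) * rho TYPE('v \<times> 'z)) in
            (AE n in lborel. fourier_converges br f \<zeta> n) \<and>
            fourier br f \<zeta> \<in> borel_measurable lborel \<and>
            Lq_norm lborel (ennreal q) (fourier br f \<zeta>) \<le> ennreal C * weak_norm haar_S p f)))"
proof (intro conjI allI impI)
  fix f :: "('v, 'z) DR \<Rightarrow> complex" and q :: ennreal and \<alpha> :: real
  assume "integrable haar_S f" "1 \<le> q"
  then show "let \<zeta> = Complex \<alpha> (gamma_exp q * rho TYPE('v \<times> 'z)) in
          (AE n in lborel. fourier_converges br f \<zeta> n) \<and>
          fourier br f \<zeta> \<in> borel_measurable lborel \<and>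
          Lq_norm lborel q (fourier br f \<zeta>) \<le> ennreal (\<integral>x. norm (f x) \<partial>haar_S)"
    unfolding Let_def
    by (intro conjI fourier_L1_bound[OF assms] fourier_measurable[OF assms] borel_measurable_integrable)
next
  fix p q :: real
  assume "1 < p" "p < 2" "p < q" "q < p / (p - 1)"
  from fourier_weak_Lp_bound[OF assms this(1,3,4)] obtain C where C: "0 < C" and bound:
    "\<And>f \<alpha> W. f \<in> borel_measurable haar_S \<Longrightarrow> 0 < W \<Longrightarrow> weak_norm haar_S p f \<le> ennreal W \<Longrightarrow>
      (AE n in lborel. fourier_converges br f (Complex \<alpha> (gamma_exp (ennreal q) * rho TYPE('v \<times> 'z))) n) \<and>
      Lq_norm lborel (ennreal q) (fourier br f (Complex \<alpha> (gamma_exp (ennreal q) * rho TYPE('v \<times> 'z)))) \<le> ennreal (C * W)"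
    by blast
  show "\<exists>C :: real. \<forall>f \<alpha>. f \<in> weak_Lp haar_S p \<longrightarrow>
          (let \<zeta> = Complex \<alpha> (gamma_exp (ennreal q) * rho TYPE('v \<times> 'z)) in
            (AE n in lborel. fourier_converges br f \<zeta> n) \<and>
            fourier br f \<zeta> \<in> borel_measurable lborel \<and>
            Lq_norm lborel (ennreal q) (fourier br f \<zeta>) \<le> ennreal C * weak_norm haar_S p f)"
  proof (intro exI allI impI, unfold Let_def, intro conjI)
    \<comment> \<open>The bound is applied with \<open>W\<close> slightly above the weak norm \<open>w\<close>, as \<open>w\<close> may vanish.\<close>
    fix f :: "('v, 'z) DR \<Rightarrow> complex" and \<alpha> :: real
    assume "f \<in> weak_Lp haar_S p"
    then have f: "f \<in> borel_measurable haar_S" and fin: "weak_norm haar_S p f < \<infinity>"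
      by (auto simp: weak_Lp_def)
    obtain w where w: "weak_norm haar_S p f = ennreal w" "0 \<le> w"
      using fin by (cases "weak_norm haar_S p f") auto
    let ?\<zeta> = "Complex \<alpha> (gamma_exp (ennreal q) * rho TYPE('v \<times> 'z))"
    have W: "weak_norm haar_S p f \<le> ennreal (w + d)" if "0 < d" for d
      using that w by (simp add: ennreal_leI)
    show "AE n in lborel. fourier_converges br f ?\<zeta> n"
      using bound[OF f _ W[of 1], of \<alpha>] w by simp
    show "fourier br f ?\<zeta> \<in> borel_measurable lborel"
      by (rule fourier_measurable[OF assms f])
    show "Lq_norm lborel (ennreal q) (fourier br f ?\<zeta>) \<le> ennreal C * weak_norm haar_S p f"
    proof (rule ennreal_le_epsilon)
      fix d :: real
      assume d: "0 < d"
      have "Lq_norm lborel (ennreal q) (fourier br f ?\<zeta>) \<le> ennreal (C * (w + d / C))"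
        using bound[OF f _ W[of "d / C"], of \<alpha>] w C d by (simp add: add_nonneg_pos)
      also have "\<dots> = ennreal C * weak_norm haar_S p f + ennreal d"
        using C w d by (simp add: distrib_left ennreal_mult)
      finally show "Lq_norm lborel (ennreal q) (fourier br f ?\<zeta>) \<le> ennreal C * weak_norm haar_S p f + ennreal d" .
    qed
  qed
qed

end
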